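(* Let $X$ be a Banach space and suppose that the linear equation $v'=A(t)v$ admits a $\rho$-nonuniform exponential trichotomy, i.e. a generalized trichotomy with bounds $$\alpha_{t,s}=\begin{cases}D e^{a[\rho(t)-\rho(s)]+\varepsilon|\rho(s)|}&\text{for } t\ge s,\\ D e^{c[\rho(s)-\rho(t)]+\varepsilon|\rho(s)|}&\text{for } t\le s,\end{cases}\qquad \beta^+_{t,s}=De^{d[\rho(t)-\rho(s)]+\varepsilon|\rho(s)|}\ \ (t\ge s),\qquad \beta^-_{t,s}=De^{b[\rho(s)-\rho(t)]+\varepsilon|\rho(s)|}\ \ (t\le s),$$ where $\rho\colon\mathbb{R}\to\mathbb{R}$ is an odd increasing differentiable function with $\lim_{t\to+\infty}\rho(t)=+\infty$ and $a,b,c,d,D,\varepsilon\in\mathbb{R}$ with $D\ge1$, $\varepsilon\ge0$. Suppose that $f\colon\mathbb{R}\times X\to X$ is a continuous function such that $f(t,0)=0$ and $\operatorname{Lip}(f_t)<+\infty$ for every $t\in\mathbb{R}$, and $$\operatorname{Lip}(f_r)\le\frac{\delta\rho'(r)}{D^2e^{2\varepsilon|\rho(r)|}}\min\left\{-c-d-\varepsilon\operatorname{sgn}(r),\ -a-b+\varepsilon\operatorname{sgn}(r),\ \frac{D\gamma}{2}e^{(\varepsilon-\gamma)|\rho(r)|}\right\}$$ for every $r\in\mathbb{R}\setminus\{0\}$, where $\delta<1/6$ and $$\gamma=\varepsilon\ \text{ if }\ \varepsilon>0\qquad\text{and}\qquad 0<\gamma<\frac{2}{D}\min\{-c-d,-a-b\}\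 \text{ if }\ \varepsilon=0.$$ Assume $\omega>0$. If $$a+b+\varepsilon<0\qquad\text{and}\qquad c+d+\varepsilon<0,$$ then the equation $v'=A(t)v+f(t,v)$ admits a global Lipschitz invariant center manifold, i.e., there is $N\in(0,1)$ and a unique $\varphi\in\mathcal{A}_N$ such that $\Psi_\tau(\mathcal{V}_\varphi)\subseteq\mathcal{V}_\varphi$ for every $\tau\in\mathbb{R}$ and $$\|\Psi_{t-s}(p_{s,\xi})-\Psi_{t-s}(p_{s,\bar\xi})\|\le\begin{cases}\dfrac{DN}{\omega}\,e^{a[\rho(t)-\rho(s)]+\varepsilon|\rho(s)|}\,\|\xi-\bar\xi\|&\text{if } t\ge s,\\[3mm]\dfrac{DN}{\omega}\,e^{c[\rho(s)-\rho(t)]+\varepsilon|\rho(s)|}\,\|\xi-\bar\xi\|&\text{if } t\le s,\end{cases}$$ for all $(s,\xi),(s,\bar\xi)\in G$, where $p_{s,\xi}=(s,\xi,\varphi(s,\xi))$ and $p_{s,\bar\xi}=(s,\bar\xi,\varphi(s,\bar\xi))$.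
   Context: $X$ is a Banach space, $B(X)$ the Banach algebra of bounded linear operators on $X$, and $A\colon\mathbb{R}\to B(X)$ is continuous. $T_{t,s}$ ($t,s\in\mathbb{R}$) is the evolution operator of $v'=A(t)v$: every solution satisfies $v(t)=T_{t,s}v(s)$. Invariant splitting: for every $t\in\mathbb{R}$ there are bounded projections $P_t,Q^+_t,Q^-_t\in B(X)$ such that, for all $t,s\in\mathbb{R}$: $P_t+Q^+_t+Q^-_t=\mathrm{Id}$; $P_tQ^+_t=0$; $P_tT_{t,s}=T_{t,s}P_s$; $Q^+_tT_{t,s}=T_{t,s}Q^+_s$. Put $E_t=P_t(X)$, $F^+_t=Q^+_t(X)$, $F^-_t=Q^-_t(X)$; $E_t\times F^+_t\times F^-_t$ is identified with $E_t\oplus F^+_t\oplus F^-_t=X$. Generalized trichotomy: let $\mathbb{R}^2_{\ge}=\{(t,s)\in\mathbb{R}^2: t\ge s\}$, $\mathbb{R}^2_{\le}=\{(t,s)\in\mathbb{R}^2: t\le s\}$. Given positive functions $\alpha_{t,s}$ on $\mathbb{R}^2$, $\beta^+_{t,s}$ on $\mathbb{R}^2_\ge$, $\beta^-_{t,s}$ on $\mathbb{R}^2_\le$, the equation $v'=A(t)v$ admits a generalized trichotomy with these bounds if it admits an invariant splitting such that $\|T_{t,s}P_s\|\le\alpha_{t,s}$ for all $(t,s)\in\mathbb{R}^2$, $\|T_{t,s}Q^+_s\|\le\beta^+_{t,s}$ for all $(t,s)\in\mathbb{R}^2_\ge$, and $\|T_{t,s}Q^-_s\|\le\beta^-_{t,s}$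 for all $(t,s)\in\mathbb{R}^2_\le$. For $f\colon\mathbb{R}\times X\to X$, $f_t(x)=f(t,x)$ and $\operatorname{Lip}(f_t)=\sup\{\|f(t,x)-f(t,y)\|/\|x-y\|: x,y\in X,\ x\ne y\}$. The constant $\omega$ is $$\omega:=\sup_{s\in\mathbb{R}}\left[\int_{-\infty}^s\beta^+_{s,r}\operatorname{Lip}(f_r)\,\alpha_{r,s}\,dr+\int_s^{+\infty}\beta^-_{s,r}\operatorname{Lip}(f_r)\,\alpha_{r,s}\,dr\right].$$ Flow: for $s\in\mathbb{R}$ and $v_s=(\xi,\eta^+,\eta^-)\in E_s\times F^+_s\times F^-_s$, let $(x(t,s,v_s),y^+(t,s,v_s),y^-(t,s,v_s))\in E_t\times F^+_t\times F^-_t$, $t\in\mathbb{R}$, be the only solution of $v'=A(t)v+f(t,v)$, $v(s)=v_s$. For $\tau\in\mathbb{R}$, $\Psi_\tau(s,v_s)=(s+\tau,x(s+\tau,s,v_s),y^+(s+\tau,s,v_s),y^-(s+\tau,s,v_s))\in\mathbb{R}\times X$. A difference of two points of $\mathbb{R}\times X$ with the same first coordinate is measured by the norm of $X$ of its second component. $G=\bigcup_{t\in\mathbb{R}}\{t\}\times E_t$. For $N>0$, $\mathcal{A}_N$ is the set of all continuous $\varphi\colon G\to X$ such that $\varphi(t,0)=0$ for all $t\in\mathbb{R}$; $\varphi(t,\xi)\in F^+_t\oplus F^-_t$ for all $(t,\xi)\in G$; and $\|\varphi(t,\xi)-\varphi(t,\bar\xi)\|\le N\|\xi-\bar\xi\|$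 for all $(t,\xi),(t,\bar\xi)\in G$. The graph of $\varphi$ is $\mathcal{V}_\varphi=\{(s,\xi,\varphi(s,\xi)):(s,\xi)\in G\}\subseteq\mathbb{R}\times X$. *)

theory Defs
  imports "HOL-Analysis.Analysis"
begin

text \<open>Operator-valued families are curried: \<open>T t s\<close> stands for $T_{t,s}$.\<close>

definition ode_solution :: "(real \<Rightarrow> 'a::banach \<Rightarrow> 'a) \<Rightarrow> (real \<Rightarrow> 'a) \<Rightarrow> bool" where
  "ode_solution g v \<longleftrightarrow> (\<forall>t. (v has_vector_derivative g t (v t)) (at t))"

text \<open>For continuous \<open>A\<close> there is a global solution through every \<open>(s, x)\<close>, so this
  property determines \<open>T\<close> uniquely.\<close>

definition evolution_operator ::
    "(real \<Rightarrow> 'a::banach \<Rightarrow>\<^sub>L 'a) \<Rightarrow> (real \<Rightarrow> real \<Rightarrow> 'a \<Rightarrow>\<^sub>L 'a) \<Rightarrow> bool" where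
  "evolution_operator A T \<longleftrightarrow>
     (\<forall>v. ode_solution (\<lambda>t x. A t x) v \<longrightarrow> (\<forall>t s. v t = T t s (v s)))"

definition invariant_splitting ::
    "(real \<Rightarrow> real \<Rightarrow> 'a::banach \<Rightarrow>\<^sub>L 'a) \<Rightarrow> (real \<Rightarrow> 'a \<Rightarrow>\<^sub>L 'a) \<Rightarrow>
     (real \<Rightarrow> 'a \<Rightarrow>\<^sub>L 'a) \<Rightarrow> (real \<Rightarrow> 'a \<Rightarrow>\<^sub>L 'a) \<Rightarrow> bool" where
  "invariant_splitting T P Qp Qm \<longleftrightarrow>
     (\<forall>t. P t o\<^sub>L P t = P t \<and> Qp t o\<^sub>L Qp t = Qp t \<and> Qm t o\<^sub>L Qm t = Qm t) \<and>
     (\<forall>t. P t + Qp t + Qm t = id_blinfun) \<and>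
     (\<forall>t. P t o\<^sub>L Qp t = 0) \<and>
     (\<forall>t s. P t o\<^sub>L T t s = T t s o\<^sub>L P s) \<and>
     (\<forall>t s. Qp t o\<^sub>L T t s = T t s o\<^sub>L Qp s)"

text \<open>The bounds \<open>\<beta>p\<close> and \<open>\<beta>m\<close> are total functions here, but only their values
  on $\{t \ge s\}$ and $\{t \le s\}$ respectively are ever used.\<close>

definition generalized_trichotomy ::
    "(real \<Rightarrow> real \<Rightarrow> 'a::banach \<Rightarrow>\<^sub>L 'a) \<Rightarrow> (real \<Rightarrow> 'a \<Rightarrow>\<^sub>L 'a) \<Rightarrow>
     (real \<Rightarrow> 'a \<Rightarrow>\<^sub>L 'a) \<Rightarrow> (real \<Rightarrow> 'a \<Rightarrow>\<^sub>L 'a) \<Rightarrow>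
     (real \<Rightarrow> real \<Rightarrow> real) \<Rightarrow> (real \<Rightarrow> real \<Rightarrow> real) \<Rightarrow> (real \<Rightarrow> real \<Rightarrow> real) \<Rightarrow> bool" where
  "generalized_trichotomy T P Qp Qm \<alpha> \<beta>p \<beta>m \<longleftrightarrow>
     invariant_splitting T P Qp Qm \<and>
     (\<forall>t s. 0 < \<alpha> t s) \<and> (\<forall>t s. s \<le> t \<longrightarrow> 0 < \<beta>p t s) \<and> (\<forall>t s. t \<le> s \<longrightarrow> 0 < \<beta>m t s) \<and>
     (\<forall>t s. norm (T t s o\<^sub>L P s) \<le> \<alpha> t s) \<and>
     (\<forall>t s. s \<le> t \<longrightarrow> norm (T t s o\<^sub>L Qp s) \<le> \<beta>p t s) \<and>
     (\<forall>t s. t \<le> s \<longrightarrow> norm (T t s o\<^sub>L Qm s) \<le> \<beta>m t s)"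

definition rho_alpha ::
    "(real \<Rightarrow> real) \<Rightarrow> real \<Rightarrow> real \<Rightarrow> real \<Rightarrow> real \<Rightarrow> real \<Rightarrow> real \<Rightarrow> real" where
  "rho_alpha \<rho> D \<epsilon> a c t s =
     (if s \<le> t then D * exp (a * (\<rho> t - \<rho> s) + \<epsilon> * \<bar>\<rho> s\<bar>)
      else D * exp (c * (\<rho> s - \<rho> t) + \<epsilon> * \<bar>\<rho> s\<bar>))"

definition rho_beta_plus ::
    "(real \<Rightarrow> real) \<Rightarrow> real \<Rightarrow> real \<Rightarrow> real \<Rightarrow> real \<Rightarrow> real \<Rightarrow> real" where
  "rho_beta_plus \<rho> D \<epsilon> d t s = D * exp (d * (\<rho> t - \<rho> s) + \<epsilon> * \<bar>\<rho> s\<bar>)"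

definition rho_beta_minus ::
    "(real \<Rightarrow> real) \<Rightarrow> real \<Rightarrow> real \<Rightarrow> real \<Rightarrow> real \<Rightarrow> real \<Rightarrow> real" where
  "rho_beta_minus \<rho> D \<epsilon> b t s = D * exp (b * (\<rho> s - \<rho> t) + \<epsilon> * \<bar>\<rho> s\<bar>)"

text \<open>Valued in \<^typ>\<open>ennreal\<close>, so that an unbounded difference quotient gives \<open>\<infinity>\<close>,
  and the zero space gives \<open>0\<close>.\<close>

definition Lip :: "('a::real_normed_vector \<Rightarrow> 'a) \<Rightarrow> ennreal" where
  "Lip g = (SUP (x, y) \<in> {(x, y). x \<noteq> y}. ennreal (norm (g x - g y) / norm (x - y)))"

definition omega_const ::
    "(real \<Rightarrow> real \<Rightarrow> real) \<Rightarrow> (real \<Rightarrow> real \<Rightarrow> real) \<Rightarrow> (real \<Rightarrow> real \<Rightarrow> real) \<Rightarrow>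
     (real \<Rightarrow> 'a::real_normed_vector \<Rightarrow> 'a) \<Rightarrow> ennreal" where
  "omega_const \<alpha> \<beta>p \<beta>m f =
     (SUP s. (\<integral>\<^sup>+ r \<in> {..s}. ennreal (\<beta>p s r) * Lip (f r) * ennreal (\<alpha> r s) \<partial>lborel) +
             (\<integral>\<^sup>+ r \<in> {s..}. ennreal (\<beta>m s r) * Lip (f r) * ennreal (\<alpha> r s) \<partial>lborel))"

text \<open>A triple in $E_t \times F^+_t \times F^-_t$ is represented by its sum in $X$; the
  components $x, y^+, y^-$ of a solution \<open>v\<close> are recovered by applying the projections at
  time \<open>t\<close> to \<open>v t\<close>.\<close>

definition ivp_solution ::
    "(real \<Rightarrow> 'a::banach \<Rightarrow>\<^sub>L 'a) \<Rightarrow> (real \<Rightarrow> 'a \<Rightarrow> 'a) \<Rightarrow> real \<Rightarrow> 'a \<Rightarrow> real \<Rightarrow> 'a" where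
  "ivp_solution A f s x = (THE v. ode_solution (\<lambda>t y. A t y + f t y) v \<and> v s = x)"

definition flow_map ::
    "(real \<Rightarrow> 'a::banach \<Rightarrow>\<^sub>L 'a) \<Rightarrow> (real \<Rightarrow> 'a \<Rightarrow> 'a) \<Rightarrow> real \<Rightarrow> real \<times> 'a \<Rightarrow> real \<times> 'a" where
  "flow_map A f \<tau> = (\<lambda>(s, x). (s + \<tau>, ivp_solution A f s x (s + \<tau>)))"

definition center_bundle :: "(real \<Rightarrow> 'a::banach \<Rightarrow>\<^sub>L 'a) \<Rightarrow> (real \<times> 'a) set" where
  "center_bundle P = {(t, \<xi>). \<xi> \<in> range (P t)}"

text \<open>Functions on $G$ are represented by total functions that take the value
  \<^const>\<open>undefined\<close> off \<open>center_bundle P\<close>; hence equality in \<open>A_N\<close> is equality of functions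
  on $G$.\<close>

definition A_N ::
    "(real \<Rightarrow> 'a::banach \<Rightarrow>\<^sub>L 'a) \<Rightarrow> (real \<Rightarrow> 'a \<Rightarrow>\<^sub>L 'a) \<Rightarrow> (real \<Rightarrow> 'a \<Rightarrow>\<^sub>L 'a) \<Rightarrow>
     real \<Rightarrow> (real \<times> 'a \<Rightarrow> 'a) set" where
  "A_N P Qp Qm N = {\<phi> \<in> center_bundle P \<rightarrow>\<^sub>E UNIV.
     continuous_on (center_bundle P) \<phi> \<and>
     (\<forall>t. \<phi> (t, 0) = 0) \<and>
     (\<forall>(t, \<xi>) \<in> center_bundle P. \<exists>u \<in> range (Qp t). \<exists>w \<in> range (Qm t). \<phi> (t, \<xi>) = u + w) \<and>
     (\<forall>t. \<forall>\<xi> \<in> range (P t). \<forall>\<xi>' \<in> range (P t).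
        norm (\<phi> (t, \<xi>) - \<phi> (t, \<xi>')) \<le> N * norm (\<xi> - \<xi>'))}"

definition graph_point :: "(real \<times> 'a::banach \<Rightarrow> 'a) \<Rightarrow> real \<Rightarrow> 'a \<Rightarrow> real \<times> 'a" where
  "graph_point \<phi> s \<xi> = (s, \<xi> + \<phi> (s, \<xi>))"

definition manifold :: "(real \<Rightarrow> 'a::banach \<Rightarrow>\<^sub>L 'a) \<Rightarrow> (real \<times> 'a \<Rightarrow> 'a) \<Rightarrow> (real \<times> 'a) set" where
  "manifold P \<phi> = {graph_point \<phi> s \<xi> | s \<xi>. (s, \<xi>) \<in> center_bundle P}"

end

theory Submission
  imports Defs
begin

text \<open>
  The manifold consists of all solutions of the perturbed equation that grow no faster than the
  center part of the linear equation: call a solution \<open>v\<close> a \<^emph>\<open>center solution\<close> if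
  \<open>norm (v t) \<le> K * \<alpha> t 0\<close> for some \<open>K\<close>. Any set of points \<open>(s, v s)\<close> with \<open>v\<close> ranging over a family
  of solutions is invariant, so the point is to show that for every \<open>s\<close> and every \<open>\<xi>\<close> in the range of
  \<open>P s\<close> there is exactly one center solution with \<open>P s (v s) = \<xi>\<close>, and that \<open>v s - \<xi>\<close> is Lipschitz
  in \<open>\<xi>\<close>.

  Consider first \<open>u' = A u + F\<close>. In the variable \<open>y t = T 0 t (u t)\<close> this is \<open>y' = T 0 t (F t)\<close>, and
  \<open>u\<close> grows slowly only if the stable component of \<open>y\<close> vanishes at \<open>-\<infinity>\<close> and the unstable one
  at \<open>+\<infinity>\<close>; conversely these two limits together with \<open>P s (u s)\<close> determine \<open>u\<close>. If \<open>F\<close> is bounded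
  by \<open>Lip (f r) * M * \<alpha> r s\<close>, the bounds of the trichotomy are submultiplicative up to a factor
  \<open>D * exp (\<epsilon> * \<bar>\<rho> r\<bar>)\<close>, and the third term of the minimum in the hypothesis on \<open>Lip (f r)\<close> turns
  this factor times \<open>Lip (f r)\<close> into the derivative of a function of total increment \<open>\<delta>\<close>. Hence
  \<open>norm (u t) \<le> (norm (P s (u s)) + 2 * \<delta> * M) * \<alpha> t s\<close> (lemma \<open>tame_estimate\<close>). At \<open>t = s\<close> the first
  two terms of the minimum give the sharper bound \<open>2 * \<delta> * M\<close>, without the weight, for the hyperbolic
  component of \<open>u s\<close> (\<open>tame_hyperbolic_estimate\<close>); the same computation shows \<open>\<omega> \<le> 2 * \<delta>\<close>
  (\<open>omega_le\<close>).

  Since \<open>2 * \<delta> < 1\<close>, putting \<open>F = f v\<close> makes \<open>v \<mapsto> u\<close> a contraction in the norm weighted by \<open>\<alpha> t s\<close>,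
  which yields the center solutions. Applied to the difference of two of them, the
  estimates give \<open>norm (v t - w t) \<le> norm (\<xi> - \<xi>') / (1 - 2 * \<delta>) * \<alpha> t s\<close> and the Lipschitz constant
  \<open>2 * \<delta> / (1 - 2 * \<delta>)\<close> for the graph. As \<open>\<delta> < 1 / 6\<close>, the latter is below \<open>1 / 2\<close>, and
  \<open>1 / (1 - 2 * \<delta>) \<le> 3 / 2 \<le> (1 / 2) / \<omega>\<close>; so \<open>N = 1 / 2\<close> serves. For uniqueness, the growth bound says
  that the orbits on any competing graph are center solutions, and these are determined by their
  center component.

  The comparison of the exponents uses \<open>d \<le> a\<close> and \<open>b \<le> c\<close>. These hold whenever \<open>P 0 \<noteq> 0\<close>, because then
  \<open>\<alpha> 0 t * \<alpha> t 0\<close> cannot tend to zero, which forces \<open>a + c + \<epsilon> \<ge> 0\<close>. If \<open>P 0 = 0\<close>, then all fibres of the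
  center bundle are zero and so is the manifold.

  All integrals with values in the Banach space are avoided by comparing increments:
  \<open>norm (y t - y s) \<le> K t - K s\<close> as soon as \<open>norm (y' r) \<le> K' r\<close> off a finite set
  (\<open>norm_increment_le\<close>). Exceptional points must be admitted because nothing but finiteness
  is known about \<open>Lip (f 0)\<close>, and because \<open>\<bar>\<rho>\<bar>\<close> need not be differentiable at \<open>0\<close>.
\<close>

section \<open>Increments, antiderivatives and weighted contractions\<close>

text \<open>The mean value inequality with a finite exceptional set and a majorant \<open>k\<close> that need not be
  continuous: both increments are gauge integrals of their derivatives.\<close>

lemma norm_increment_le:
  fixes y :: "real \<Rightarrow> 'a::banach" and K :: "real \<Rightarrow> real"
  assumes st: "s \<le> t" and S: "finite S"
    and y_cont: "continuous_on {s..t} y" and K_cont: "continuous_on {s..t} K"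
    and y': "\<And>r. s < r \<Longrightarrow> r < t \<Longrightarrow> r \<notin> S \<Longrightarrow> (y has_vector_derivative y' r) (at r)"
    and K': "\<And>r. s < r \<Longrightarrow> r < t \<Longrightarrow> r \<notin> S \<Longrightarrow> (K has_real_derivative k r) (at r)"
    and bound: "\<And>r. s < r \<Longrightarrow> r < t \<Longrightarrow> r \<notin> S \<Longrightarrow> norm (y' r) \<le> k r"
  shows "norm (y t - y s) \<le> K t - K s"
proof -
  define Z where "Z = insert s (insert t S)"
  have Z: "finite Z" using S by (simp add: Z_def)
  have "(y' has_integral (y t - y s)) {s..t}"
    by (rule fundamental_theorem_of_calculus_interior_strong[OF S st _ y_cont]) (use y' in auto)
  then have y_int: "((\<lambda>r. if r \<in> Z then 0 else y' r) has_integral (y t - y s)) {s..t}"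
    by (rule has_integral_spike_finite[OF Z, rotated]) auto
  have "(k has_integral (K t - K s)) {s..t}"
    by (rule fundamental_theorem_of_calculus_interior_strong[OF S st _ K_cont])
      (use K' in \<open>auto simp: has_real_derivative_iff_has_vector_derivative\<close>)
  then have K_int: "((\<lambda>r. if r \<in> Z then 0 else k r) has_integral (K t - K s)) {s..t}"
    by (rule has_integral_spike_finite[OF Z, rotated]) auto
  have "norm (if r \<in> Z then 0 else y' r) \<le> (if r \<in> Z then 0 else k r)" if "r \<in> {s..t}" for r
    using bound[of r] that by (auto simp: Z_def)
  then have "norm (integral {s..t} (\<lambda>r. if r \<in> Z then 0 else y' r))
      \<le> integral {s..t} (\<lambda>r. if r \<in> Z then 0 else k r)"
    by (intro Henstock_Kurzweil_Integration.integral_norm_bound_integral)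
      (use y_int K_int in \<open>auto simp: has_integral_integrable_integral\<close>)
  then show ?thesis
    using integral_unique[OF y_int] integral_unique[OF K_int] by simp
qed

lemma antiderivative_on_UNIV:
  fixes F :: "real \<Rightarrow> 'a::banach"
  assumes "continuous_on UNIV F"
  obtains G where "\<And>t. (G has_vector_derivative F t) (at t)"
proof -
  define G where "G = (\<lambda>t. integral {0..t} F - integral {t..0} F)"
  have "(G has_vector_derivative F t) (at t)" for t
  proof -
    obtain n :: real where n: "\<bar>t\<bar> < n" using gt_ex by blast
    have F_int: "F integrable_on {p..q}" for p q
      by (rule integrable_continuous_real) (use assms continuous_on_subset in blast)
    \<comment> \<open>On a neighbourhood of \<open>t\<close> the two-sided integral is a one-sided one, up to a constant.\<close>
    have eq: "G u = integral {-n..u} F - integral {-n..0} F" if "u \<in> {-n<..<n}" for u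
    proof (cases "0 \<le> u")
      case True
      then have "integral {-n..0} F + integral {0..u} F = integral {-n..u} F"
        using that by (intro Henstock_Kurzweil_Integration.integral_combine F_int) auto
      moreover have "integral {u..0} F = 0" using True by (cases "u = 0") auto
      ultimately show ?thesis by (simp add: G_def algebra_simps)
    next
      case False
      then have "integral {-n..u} F + integral {u..0} F = integral {-n..0} F"
        using that by (intro Henstock_Kurzweil_Integration.integral_combine F_int) auto
      then show ?thesis using False by (simp add: G_def algebra_simps)
    qed
    have "((\<lambda>u. integral {-n..u} F) has_vector_derivative F t) (at t within {-n..n})"
      using n by (intro integral_has_vector_derivative continuous_on_subset[OF assms]) auto
    then have "((\<lambda>u. integral {-n..u} F - integral {-n..0} F) has_vector_derivative F t)
        (at t within {-n..n})"
      by (auto intro!: derivative_eq_intros)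
    moreover have "at t within {-n..n} = at t"
      using n by (intro at_within_interior) (auto simp: interior_atLeastAtMost_real)
    ultimately have "((\<lambda>u. integral {-n..u} F - integral {-n..0} F) has_vector_derivative F t) (at t)"
      by simp
    then show ?thesis
      by (rule has_vector_derivative_transform_within_open[of _ _ _ "{-n<..<n}"]) (use n eq in auto)
  qed
  with that show ?thesis by blast
qed

text \<open>The smallest admissible constant \<open>M\<close> satisfies \<open>M \<le> C + q * M\<close>. Some finite bound must be known
  beforehand, which is what \<open>M\<^sub>0\<close> provides.\<close>

lemma self_improving_bound:
  fixes h W :: "'b \<Rightarrow> real"
  assumes q: "q < 1" and W: "\<And>t. t \<in> I \<Longrightarrow> 0 < W t" and C: "0 \<le> C"
    and h: "\<And>t. t \<in> I \<Longrightarrow> 0 \<le> h t" "\<And>t. t \<in> I \<Longrightarrow> h t \<le> M\<^sub>0 * W t"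
    and improve: "\<And>M t. 0 \<le> M \<Longrightarrow> (\<And>t. t \<in> I \<Longrightarrow> h t \<le> M * W t) \<Longrightarrow> t \<in> I \<Longrightarrow>
      h t \<le> (C + q * M) * W t"
    and t: "t \<in> I"
  shows "h t \<le> C / (1 - q) * W t"
proof -
  define M where "M = (SUP t\<in>I. h t / W t)"
  have bdd: "bdd_above ((\<lambda>t. h t / W t) ` I)"
    using h(2) W by (intro bdd_aboveI[of _ M\<^sub>0]) (auto simp: pos_divide_le_eq)
  have upper: "h t \<le> M * W t" if "t \<in> I" for t
    using cSUP_upper[OF that bdd] W[OF that] by (simp add: M_def pos_divide_le_eq)
  have "0 \<le> M"
    using upper[OF t] h(1)[OF t] W[OF t] by (smt (verit) mult_neg_pos)
  then have "h t / W t \<le> C + q * M" if "t \<in> I" for t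
    using improve[OF _ upper that] W[OF that] by (simp add: pos_divide_le_eq)
  then have "M \<le> C + q * M"
    unfolding M_def using t by (intro cSUP_least) auto
  then have "M \<le> C / (1 - q)"
    using q by (simp add: pos_le_divide_eq algebra_simps)
  then show ?thesis
    using upper[OF t] W[OF t] by (smt (verit) mult_right_mono)
qed

text \<open>Banach's fixed point theorem in the space of continuous functions of size at most a multiple of the
  weight \<open>W\<close>; dividing by \<open>W\<close> identifies it with the bounded continuous functions. The map is given
  by a relation \<open>R\<close>, since its values will be obtained from existence theorems; the contraction
  property makes \<open>R\<close> functional.\<close>

lemma weighted_fixed_point:
  fixes W :: "'b::metric_space \<Rightarrow> real" and R :: "('b \<Rightarrow> 'a::banach) \<Rightarrow> ('b \<Rightarrow> 'a) \<Rightarrow> bool"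
  assumes W: "continuous_on UNIV W" "\<And>t. 0 < W t" and q: "0 \<le> q" "q < 1"
    and ex: "\<And>v M. continuous_on UNIV v \<Longrightarrow> (\<And>t. norm (v t) \<le> M * W t) \<Longrightarrow>
      \<exists>u M'. R v u \<and> continuous_on UNIV u \<and> (\<forall>t. norm (u t) \<le> M' * W t)"
    and contr: "\<And>v v' u u' M t. R v u \<Longrightarrow> R v' u' \<Longrightarrow> 0 \<le> M \<Longrightarrow>
      (\<And>t. norm (v t - v' t) \<le> M * W t) \<Longrightarrow> norm (u t - u' t) \<le> q * M * W t"
  shows "\<exists>v M. R v v \<and> continuous_on UNIV v \<and> (\<forall>t. norm (v t) \<le> M * W t)"
proof -
  define lift :: "('b \<Rightarrow>\<^sub>C 'a) \<Rightarrow> 'b \<Rightarrow> 'a" where "lift z = (\<lambda>t. W t *\<^sub>R apply_bcontfun z t)" for z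
  have lift_cont: "continuous_on UNIV (lift z)" for z
    unfolding lift_def by (intro continuous_intros W) auto
  have lift_bound: "norm (lift z t) \<le> norm z * W t" for z t
    using W(2)[of t] norm_bounded[of z t] by (simp add: lift_def mult.commute)
  have unlift: "\<exists>z. lift z = u" if "continuous_on UNIV u" "\<And>t. norm (u t) \<le> M * W t" for u M
  proof -
    have "norm (u t /\<^sub>R W t) \<le> M" for t
    proof -
      have "norm (u t /\<^sub>R W t) = norm (u t) / W t"
        using W(2)[of t] by (simp add: divide_inverse)
      then show ?thesis using that(2)[of t] W(2)[of t] by (simp add: pos_divide_le_eq)
    qed
    moreover have "continuous_on UNIV (\<lambda>t. u t /\<^sub>R W t)"
      by (intro continuous_intros that W) (use W(2) in \<open>auto simp: less_imp_neq[symmetric]\<close>)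
    ultimately have "(\<lambda>t. u t /\<^sub>R W t) \<in> bcontfun" by (intro bcontfun_normI)
    then have "lift (Bcontfun (\<lambda>t. u t /\<^sub>R W t)) = u"
      using W(2) by (auto simp: lift_def Bcontfun_inverse fun_eq_iff less_imp_neq[symmetric])
    then show ?thesis by blast
  qed
  have "\<exists>z'. R (lift z) (lift z')" for z
    using ex[OF lift_cont[of z], of "norm z"] lift_bound[of z] unlift by metis
  then obtain \<Theta> where \<Theta>: "\<And>z. R (lift z) (lift (\<Theta> z))" by metis
  have "dist (\<Theta> z) (\<Theta> z') \<le> q * dist z z'" for z z'
  proof (rule dist_bound)
    fix t
    have W0: "0 < W t" by (rule W)
    have "norm (lift z r - lift z' r) \<le> dist z z' * W r" for r
      using W(2)[of r] dist_bounded[of z r z']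
      by (simp add: lift_def dist_norm mult.commute flip: scaleR_diff_right)
    from contr[OF \<Theta> \<Theta> _ this, of t]
    have "W t * dist (\<Theta> z t) (\<Theta> z' t) \<le> W t * (q * dist z z')"
      using W0 by (simp add: lift_def dist_norm mult_ac flip: scaleR_diff_right)
    then show "dist (\<Theta> z t) (\<Theta> z' t) \<le> q * dist z z'"
      using W0 by simp
  qed
  then obtain z where "\<Theta> z = z"
    using banach_fix_type[OF q, of \<Theta>] by blast
  then show ?thesis
    using \<Theta>[of z] lift_cont[of z] lift_bound[of z] by metis
qed

section \<open>Global solutions of Lipschitz equations\<close>

lemma ode_solution_continuous:
  assumes "ode_solution g v" shows "continuous_on X v"
  using assms unfolding ode_solution_def
  by (intro continuous_at_imp_continuous_on) (auto intro: has_vector_derivative_continuous)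

lemma continuous_along_path:
  assumes "continuous_on UNIV (\<lambda>(t, x). g t x)" and "continuous_on X v"
  shows "continuous_on X (\<lambda>t. g t (v t))"
proof -
  have "continuous_on X (\<lambda>t. (t, v t))"
    using assms(2) by (intro continuous_on_Pair continuous_on_id)
  from continuous_on_compose2[OF assms(1) this] show ?thesis by simp
qed

text \<open>The Lipschitz constant \<open>l\<close> enters only through its antiderivative \<open>L\<close>, so it may be discontinuous
  and locally unbounded; all that matters is the weight \<open>exp (2 * \<bar>L t - L s\<bar>)\<close>.\<close>

locale lipschitz_ode =
  fixes g :: "real \<Rightarrow> 'a::banach \<Rightarrow> 'a" and L l :: "real \<Rightarrow> real" and S :: "real set"
  assumes g_cont: "continuous_on UNIV (\<lambda>(t, x). g t x)"
    and g_zero: "\<And>t. g t 0 = 0"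
    and g_lip: "\<And>t x y. t \<notin> S \<Longrightarrow> norm (g t x - g t y) \<le> l t * norm (x - y)"
    and L_cont: "continuous_on UNIV L"
    and L_deriv: "\<And>t. t \<notin> S \<Longrightarrow> (L has_real_derivative l t) (at t)"
    and l_nonneg: "\<And>t. t \<notin> S \<Longrightarrow> 0 \<le> l t"
    and S_finite: "finite S"
begin

definition weight :: "real \<Rightarrow> real \<Rightarrow> real" where "weight s t = exp (2 * \<bar>L t - L s\<bar>)"

lemma weight_ge_1: "1 \<le> weight s t"
  by (simp add: weight_def)

lemma L_mono: "s \<le> t \<Longrightarrow> L s \<le> L t"
  using norm_increment_le[of s t S "\<lambda>_. 0::real" L "\<lambda>_. 0" l] S_finite L_deriv l_nonneg
    continuous_on_subset[OF L_cont]
  by auto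

text \<open>Integrating \<open>l r * weight s r\<close> from \<open>s\<close> to \<open>t\<close> gives less than half of \<open>weight s t\<close>; this is why the
  exponent carries the factor 2. Closeness is asked for only between \<open>s\<close> and \<open>t\<close>, so that the lemma
  also applies on compact intervals.\<close>

lemma increment_of_difference:
  assumes u: "\<And>r. ((\<lambda>r. u r - u' r) has_vector_derivative g r (v r) - g r (v' r)) (at r)"
    and close: "\<And>r. r \<in> closed_segment s t \<Longrightarrow> norm (v r - v' r) \<le> M * weight s r"
    and M: "0 \<le> M"
  shows "norm ((u t - u' t) - (u s - u' s)) \<le> M / 2 * weight s t"
proof -
  have cont: "continuous_on X (\<lambda>r. u r - u' r)" for X
    using has_vector_derivative_continuous[OF u] by (intro continuous_at_imp_continuous_on) auto
  have Lc: "continuous_on X L" for X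
    using L_cont continuous_on_subset by blast
  show ?thesis
  proof (cases "s \<le> t")
    case True
    have "norm ((u t - u' t) - (u s - u' s))
        \<le> M / 2 * exp (2 * (L t - L s)) - M / 2 * exp (2 * (L s - L s))"
    proof (rule norm_increment_le[OF True S_finite cont _ u])
      show "continuous_on {s..t} (\<lambda>r. M / 2 * exp (2 * (L r - L s)))"
        by (intro continuous_intros Lc)
    next
      fix r assume r: "s < r" "r < t" "r \<notin> S"
      show "((\<lambda>r. M / 2 * exp (2 * (L r - L s))) has_real_derivative
          l r * (M * exp (2 * (L r - L s)))) (at r)"
        using L_deriv[OF r(3)] by (auto intro!: derivative_eq_intros)
      have "norm (v r - v' r) \<le> M * exp (2 * (L r - L s))"
        using close[of r] r L_mono[of s r] by (auto simp: weight_def closed_segment_eq_real_ivl)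
      then show "norm (g r (v r) - g r (v' r)) \<le> l r * (M * exp (2 * (L r - L s)))"
        using g_lip[OF r(3), of "v r" "v' r"] l_nonneg[OF r(3)]
        by (meson mult_left_mono order_trans)
    qed
    then show ?thesis using L_mono[OF True] M by (simp add: weight_def)
  next
    case False
    then have ts: "t \<le> s" by simp
    have "norm ((u s - u' s) - (u t - u' t))
        \<le> - (M / 2 * exp (2 * (L s - L s))) - - (M / 2 * exp (2 * (L s - L t)))"
    proof (rule norm_increment_le[OF ts S_finite cont _ u])
      show "continuous_on {t..s} (\<lambda>r. - (M / 2 * exp (2 * (L s - L r))))"
        by (intro continuous_intros Lc)
    next
      fix r assume r: "t < r" "r < s" "r \<notin> S"
      show "((\<lambda>r. - (M / 2 * exp (2 * (L s - L r)))) has_real_derivative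
          l r * (M * exp (2 * (L s - L r)))) (at r)"
        using L_deriv[OF r(3)] by (auto intro!: derivative_eq_intros)
      have "norm (v r - v' r) \<le> M * exp (2 * (L s - L r))"
        using close[of r] r L_mono[of r s] by (auto simp: weight_def closed_segment_eq_real_ivl)
      then show "norm (g r (v r) - g r (v' r)) \<le> l r * (M * exp (2 * (L s - L r)))"
        using g_lip[OF r(3), of "v r" "v' r"] l_nonneg[OF r(3)]
        by (meson mult_left_mono order_trans)
    qed
    then show ?thesis using L_mono[OF ts] M by (simp add: weight_def norm_minus_commute)
  qed
qed

theorem unique_solution:
  assumes v: "ode_solution g v" and w: "ode_solution g w" and eq: "v s = w s"
  shows "v = w"
proof
  fix t
  \<comment> \<open>The difference of two arbitrary solutions is not known to be bounded by the weight globally,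
    only on compact intervals.\<close>
  define I where "I = closed_segment s t"
  have d: "((\<lambda>r. v r - w r) has_vector_derivative g r (v r) - g r (w r)) (at r)" for r
    using v w by (auto simp: ode_solution_def intro!: derivative_intros)
  have "continuous_on I (\<lambda>r. v r - w r)"
    using v w by (intro continuous_intros ode_solution_continuous)
  then have "bounded ((\<lambda>r. v r - w r) ` I)"
    by (intro compact_imp_bounded compact_continuous_image) (auto simp: I_def)
  then obtain M\<^sub>0 where M\<^sub>0: "\<And>r. r \<in> I \<Longrightarrow> norm (v r - w r) \<le> M\<^sub>0"
    by (auto simp: bounded_iff)
  have "norm (v t - w t) \<le> 0 / (1 - 1 / 2) * weight s t"
  proof (rule self_improving_bound[where I = I and h = "\<lambda>r. norm (v r - w r)" and W = "weight s"])
    fix M r assume M: "0 \<le> M" and b: "\<And>r. r \<in> I \<Longrightarrow> norm (v r - w r) \<le> M * weight s r" and r: "r \<in> I"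
    have "norm ((v r - w r) - (v s - w s)) \<le> M / 2 * weight s r"
      by (rule increment_of_difference[of v w v w, OF d _ M])
        (use b r in \<open>auto simp: I_def closed_segment_eq_real_ivl split: if_splits\<close>)
    then show "norm (v r - w r) \<le> (0 + 1 / 2 * M) * weight s r"
      using eq by simp
  next
    fix r assume r: "r \<in> I"
    then have "norm (v r - w r) \<le> M\<^sub>0" "0 \<le> M\<^sub>0"
      using M\<^sub>0[OF r] norm_ge_zero[of "v r - w r"] by linarith+
    then show "norm (v r - w r) \<le> M\<^sub>0 * weight s r"
      using weight_ge_1[of s r] mult_left_mono[of 1 "weight s r" M\<^sub>0] by simp
  qed (auto simp: weight_def I_def)
  then show "v t = w t" by simp
qed

text \<open>Since \<open>g t 0 = 0\<close>, comparing with the zero function shows that the Picard map preserves the weighted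
  space.\<close>

theorem solution_exists: "\<exists>v. ode_solution g v \<and> v s = x"
proof -
  define R where "R v u \<longleftrightarrow> (\<forall>t. (u has_vector_derivative g t (v t)) (at t)) \<and> u s = x" for v u
  have "\<exists>v M. R v v \<and> continuous_on UNIV v \<and> (\<forall>t. norm (v t) \<le> M * weight s t)"
  proof (rule weighted_fixed_point[where q = "1 / 2" and R = R and W = "weight s"])
    show "continuous_on UNIV (weight s)"
      unfolding weight_def by (intro continuous_intros L_cont)
  next
    fix v :: "real \<Rightarrow> 'a" and M assume v: "continuous_on UNIV v" and b: "\<And>t. norm (v t) \<le> M * weight s t"
    have M: "0 \<le> M"
      using order_trans[OF norm_ge_zero b[of s]] by (simp add: weight_def)
    have "continuous_on UNIV (\<lambda>t. g t (v t))"
      by (rule continuous_along_path[OF g_cont v])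
    then obtain G where G: "\<And>t. (G has_vector_derivative g t (v t)) (at t)"
      using antiderivative_on_UNIV by blast
    define u where "u = (\<lambda>t. G t - G s + x)"
    have u: "(u has_vector_derivative g t (v t)) (at t)" for t
      unfolding u_def using G by (auto intro!: derivative_eq_intros)
    have R: "R v u"
      using u by (auto simp: R_def u_def)
    have "norm (u t) \<le> (norm x + M / 2) * weight s t" for t
    proof -
      have "norm ((u t - 0) - (u s - 0)) \<le> M / 2 * weight s t"
        using increment_of_difference[of u "\<lambda>_. 0" v "\<lambda>_. 0" s t M] u b M by (simp add: g_zero)
      moreover have "u s = x" by (simp add: u_def)
      ultimately have "norm (u t) \<le> norm x + M / 2 * weight s t"
        using norm_triangle_sub[of "u t" x] by simp
      also have "norm x \<le> norm x * weight s t"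
        using weight_ge_1[of s t] mult_left_mono[of 1 "weight s t" "norm x"] by simp
      finally show ?thesis by (simp add: algebra_simps)
    qed
    moreover have "continuous_on UNIV u"
      using has_vector_derivative_continuous[OF u] by (intro continuous_at_imp_continuous_on) auto
    ultimately show "\<exists>u M'. R v u \<and> continuous_on UNIV u \<and> (\<forall>t. norm (u t) \<le> M' * weight s t)"
      using R by blast
  next
    fix v v' u u' M t
    assume R: "R v u" "R v' u'" and M: "0 \<le> M" and b: "\<And>t. norm (v t - v' t) \<le> M * weight s t"
    have "norm ((u t - u' t) - (u s - u' s)) \<le> M / 2 * weight s t"
      using R by (intro increment_of_difference[OF _ b M]) (auto simp: R_def intro!: derivative_intros)
    then show "norm (u t - u' t) \<le> 1 / 2 * M * weight s t"
      using R by (simp add: R_def)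
  qed (simp_all add: weight_def)
  then show ?thesis
    unfolding R_def ode_solution_def by blast
qed

end

section \<open>The evolution operator in operator norm\<close>

lemma ode_solution_blinfun_apply:
  fixes A V :: "real \<Rightarrow> 'a::banach \<Rightarrow>\<^sub>L 'a"
  assumes "\<And>t. (V has_vector_derivative A t o\<^sub>L V t) (at t)"
  shows "ode_solution (\<lambda>t x. A t x) (\<lambda>t. V t x)"
  unfolding ode_solution_def
proof
  fix t
  show "((\<lambda>t. V t x) has_vector_derivative A t (V t x)) (at t)"
    using bounded_linear.has_vector_derivative[OF blinfun.bounded_linear_left assms[of t], of x]
    by simp
qed

locale linear_evolution =
  fixes A :: "real \<Rightarrow> 'a::banach \<Rightarrow>\<^sub>L 'a" and T :: "real \<Rightarrow> real \<Rightarrow> 'a \<Rightarrow>\<^sub>L 'a"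
  assumes A_cont: "continuous_on UNIV A" and evolution: "evolution_operator A T"
begin

lemma norm_A_antiderivative:
  obtains L where "\<And>t. (L has_real_derivative norm (A t)) (at t)"
  using antiderivative_on_UNIV[of "\<lambda>t. norm (A t)"] A_cont
  by (auto intro!: continuous_on_norm simp: has_real_derivative_iff_has_vector_derivative)

text \<open>For the product \<open>m\<close> this covers the equation in \<open>X\<close> itself as well as the two operator
  equations \<open>V' = A V\<close> and \<open>V' = - V A\<close>.\<close>

lemma operator_ode_solution_exists:
  fixes m :: "'a \<Rightarrow>\<^sub>L 'a \<Rightarrow> 'b::banach \<Rightarrow> 'b"
  assumes m: "bounded_bilinear m" and m_norm: "\<And>B x. norm (m B x) \<le> norm B * norm x"
  shows "\<exists>v. ode_solution (\<lambda>t x. m (A t) x) v \<and> v s = x"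
proof -
  interpret m: bounded_bilinear m by (rule m)
  obtain L where L: "\<And>t. (L has_real_derivative norm (A t)) (at t)"
    by (rule norm_A_antiderivative) blast
  interpret lipschitz_ode "\<lambda>t x. m (A t) x" L "\<lambda>t. norm (A t)" "{}"
  proof
    have "continuous_on UNIV (\<lambda>z :: real \<times> 'b. A (fst z))"
      by (rule continuous_on_compose2[OF A_cont]) (auto intro!: continuous_intros)
    then have "continuous_on UNIV (\<lambda>z. m (A (fst z)) (snd z))"
      by (intro m.continuous_on) (auto intro!: continuous_intros)
    then show "continuous_on UNIV (\<lambda>(t, x). m (A t) x)" by (simp add: case_prod_beta)
    show "continuous_on UNIV L"
      using L by (intro continuous_at_imp_continuous_on) (auto intro: DERIV_isCont)
    show "norm (m (A t) x - m (A t) y) \<le> norm (A t) * norm (x - y)" for t x y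
      using m_norm[of "A t" "x - y"] by (simp add: m.diff_right)
  qed (use L in \<open>auto simp: m.zero_right\<close>)
  show ?thesis by (rule solution_exists)
qed

lemma T_solution: "ode_solution (\<lambda>t x. A t x) (\<lambda>t. T t s x)"
  and T_refl_apply: "T s s x = x"
proof -
  obtain v where v: "ode_solution (\<lambda>t x. A t x) v" "v s = x"
    using operator_ode_solution_exists[OF bounded_bilinear_blinfun_apply norm_blinfun, of s x]
    by auto
  then have "v = (\<lambda>t. T t s x)"
    using evolution by (auto simp: evolution_operator_def)
  with v show "ode_solution (\<lambda>t x. A t x) (\<lambda>t. T t s x)" "T s s x = x" by auto
qed

lemma T_refl [simp]: "T s s = id_blinfun"
  by (rule blinfun_eqI) (simp add: T_refl_apply)

lemma T_cocycle: "T t r (T r s x) = T t s x"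
  using evolution T_solution[of s x] unfolding evolution_operator_def by metis

lemma T_inverse [simp]: "T t r (T r t x) = x"
  by (simp add: T_cocycle)

text \<open>The operator solution of \<open>V' = A V\<close>, \<open>V 0 = id\<close> agrees pointwise with \<open>T t 0\<close>. Differentiability in
  operator norm is what the product rule for \<open>T 0 t (u t)\<close> requires.\<close>

lemma T_has_vector_derivative:
  "((\<lambda>t. T t 0) has_vector_derivative A t o\<^sub>L T t 0) (at t)"
proof -
  obtain V where V: "ode_solution (\<lambda>t V. A t o\<^sub>L V) V" "V 0 = id_blinfun"
    using operator_ode_solution_exists[OF bounded_bilinear_blinfun_compose norm_blinfun_compose]
    by blast
  have "V t x = T t 0 x" for t x
  proof -
    have "ode_solution (\<lambda>t x. A t x) (\<lambda>t. V t x)"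
      using V(1) by (intro ode_solution_blinfun_apply) (simp add: ode_solution_def)
    then have "V t x = T t 0 (V 0 x)"
      using evolution unfolding evolution_operator_def by blast
    then show ?thesis by (simp add: V)
  qed
  then have "V = (\<lambda>t. T t 0)"
    by (auto intro: blinfun_eqI)
  then show ?thesis using V by (auto simp: ode_solution_def)
qed

text \<open>The solution of \<open>V' = - V A\<close>, \<open>V 0 = id\<close> is a left inverse of \<open>T t 0\<close>, as \<open>V t (T t 0 x)\<close> has
  derivative zero; hence it is \<open>T 0 t\<close>.\<close>

lemma T_inverse_has_vector_derivative:
  "((\<lambda>t. T 0 t) has_vector_derivative - (T 0 t o\<^sub>L A t)) (at t)"
proof -
  have "bounded_bilinear (\<lambda>B V :: 'a \<Rightarrow>\<^sub>L 'a. V o\<^sub>L (- B))"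
    by (rule bounded_bilinear.comp[OF bounded_bilinear.flip[OF bounded_bilinear_blinfun_compose]
          bounded_linear_minus[OF bounded_linear_ident] bounded_linear_ident])
  moreover have "norm (V o\<^sub>L (- B)) \<le> norm B * norm V" for B V :: "'a \<Rightarrow>\<^sub>L 'a"
    using norm_blinfun_compose[of V "- B"] by (simp add: mult.commute)
  ultimately obtain V where V: "ode_solution (\<lambda>t V. V o\<^sub>L (- A t)) V" "V 0 = id_blinfun"
    using operator_ode_solution_exists by blast
  then have V': "(V has_vector_derivative V t o\<^sub>L (- A t)) (at t)" for t
    by (simp add: ode_solution_def)
  have "V t (T t 0 x) = x" for t x
  proof -
    have "((\<lambda>t. V t (T t 0 x)) has_vector_derivative 0) (at t)" for t
      using bounded_bilinear.has_vector_derivative[OF bounded_bilinear_blinfun_apply V'[of t]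
          T_solution[of 0 x, unfolded ode_solution_def, rule_format, of t]]
      by (simp add: blinfun.minus_left blinfun.minus_right)
    then obtain k where "\<And>t. V t (T t 0 x) = k"
      using has_vector_derivative_zero_constant[of UNIV "\<lambda>t. V t (T t 0 x)"] by auto
    from this[of t] this[of 0] show ?thesis by (simp add: V)
  qed
  then have "V t x = T 0 t x" for t x
    using T_inverse[of t 0 x] by metis
  then have "V = (\<lambda>t. T 0 t)"
    by (auto intro!: blinfun_eqI)
  with V'[of t] show ?thesis
    by (simp add: bounded_bilinear.minus_right[OF bounded_bilinear_blinfun_compose])
qed

lemma variation_of_constants:
  assumes u: "\<And>t. (u has_vector_derivative A t (u t) + F t) (at t)"
  shows "((\<lambda>t. T 0 t (u t)) has_vector_derivative T 0 t (F t)) (at t)"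
  using bounded_bilinear.has_vector_derivative[OF bounded_bilinear_blinfun_apply
      T_inverse_has_vector_derivative[of t] u[of t]]
  by (simp add: blinfun.add_right blinfun.minus_left)

lemma variation_of_constants_converse:
  assumes y: "\<And>t. (y has_vector_derivative T 0 t (F t)) (at t)"
  shows "((\<lambda>t. T t 0 (y t)) has_vector_derivative A t (T t 0 (y t)) + F t) (at t)"
  using bounded_bilinear.has_vector_derivative[OF bounded_bilinear_blinfun_apply
      T_has_vector_derivative[of t] y[of t]]
  by (simp add: add.commute)

lemma T_cont: "continuous_on X (\<lambda>t. T t 0)" "continuous_on X (\<lambda>t. T 0 t)"
  using has_vector_derivative_continuous[OF T_has_vector_derivative]
    has_vector_derivative_continuous[OF T_inverse_has_vector_derivative]
  by (auto intro!: continuous_at_imp_continuous_on)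

end

section \<open>Integrals of derivatives over half-lines\<close>

text \<open>Exhausting \<open>I\<close> by compact intervals, one can integrate a derivative of which measurability is not
  known beforehand; it comes from gauge integrability.\<close>

lemma nn_integral_derivative_exhaustion:
  fixes K k :: "real \<Rightarrow> real"
  assumes S: "finite S" and K_cont: "continuous_on UNIV K"
    and K': "\<And>r. r \<notin> S \<Longrightarrow> (K has_real_derivative k r) (at r)"
    and k: "\<And>r. r \<notin> S \<Longrightarrow> 0 \<le> k r"
    and pq: "\<And>n. p n \<le> q n" "\<And>n :: nat. {p n..q n} \<subseteq> {p (Suc n)..q (Suc n)}"
      "(\<Union>n. {p n..q n}) = I"
    and lim: "(\<lambda>n. K (q n) - K (p n)) \<longlonglongrightarrow> V"
  shows "(\<integral>\<^sup>+ r \<in> I. ennreal (k r) \<partial>lborel) = ennreal V"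
proof -
  define k\<^sub>0 where "k\<^sub>0 r = (if r \<in> S then 0 else k r)" for r
  have k\<^sub>0: "0 \<le> k\<^sub>0 r" for r using k by (simp add: k\<^sub>0_def)
  have incr: "{p m..q m} \<subseteq> {p n..q n}" if "m \<le> n" for m n
    by (rule lift_Suc_mono_le[of "\<lambda>n. {p n..q n}", OF pq(2) that])
  have "(k has_integral (K (q n) - K (p n))) {p n..q n}" for n
    by (rule fundamental_theorem_of_calculus_interior_strong[OF S pq(1)])
      (use K' continuous_on_subset[OF K_cont] in
        \<open>auto simp: has_real_derivative_iff_has_vector_derivative\<close>)
  then have "(k\<^sub>0 has_integral (K (q n) - K (p n))) {p n..q n}" for n
    by (rule has_integral_spike_finite[OF S, rotated]) (simp add: k\<^sub>0_def)
  moreover have "{p n..q n} \<subseteq> I" for n using pq(3) by blast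
  ultimately have
    "((\<lambda>r. if r \<in> {p n..q n} then k\<^sub>0 r else 0) has_integral (K (q n) - K (p n))) I" for n
    by (subst has_integral_restrict) auto
  then have "(k\<^sub>0 has_integral V) I"
  proof (rule has_integral_monotone_convergence_increasing)
    show "(if r \<in> {p n..q n} then k\<^sub>0 r else 0) \<le> (if r \<in> {p (Suc n)..q (Suc n)} then k\<^sub>0 r else 0)"
      for n r using pq(2)[of n] k\<^sub>0[of r] by auto
    show "(\<lambda>n. if r \<in> {p n..q n} then k\<^sub>0 r else 0) \<longlonglongrightarrow> k\<^sub>0 r" if "r \<in> I" for r
    proof (rule tendsto_eventually)
      obtain m where "r \<in> {p m..q m}" using \<open>r \<in> I\<close> pq(3) by blast
      then show "\<forall>\<^sub>F n in sequentially. (if r \<in> {p n..q n} then k\<^sub>0 r else 0) = k\<^sub>0 r"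
        using incr by (intro eventually_sequentiallyI[of m]) (metis subset_iff)
    qed
  qed (rule lim)
  then have "(\<integral>\<^sup>+ r \<in> I. ennreal (k\<^sub>0 r) \<partial>lborel) = ennreal V"
    using k\<^sub>0 by (intro nn_integral_has_integral_lebesgue')
  moreover have "AE r in lborel. r \<notin> S"
    using finite_imp_null_set_lborel[OF S] by (rule AE_not_in)
  then have "(\<integral>\<^sup>+ r \<in> I. ennreal (k\<^sub>0 r) \<partial>lborel) = (\<integral>\<^sup>+ r \<in> I. ennreal (k r) \<partial>lborel)"
    by (intro nn_integral_cong_AE) (auto simp: k\<^sub>0_def)
  ultimately show ?thesis by simp
qed

section \<open>The growth rate and its bump function\<close>

locale growth_rate =
  fixes \<rho> \<rho>' :: "real \<Rightarrow> real"
  assumes rho_odd: "\<And>t. \<rho> (- t) = - \<rho> t" and rho_mono: "mono \<rho>"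
    and rho_deriv: "\<And>t. (\<rho> has_real_derivative \<rho>' t) (at t)"
    and rho_at_top: "filterlim \<rho> at_top at_top"
begin

lemma rho_zero [simp]: "\<rho> 0 = 0"
  using rho_odd[of 0] by simp

lemma rho_le: "s \<le> t \<Longrightarrow> \<rho> s \<le> \<rho> t"
  by (rule monoD[OF rho_mono])

lemma rho'_nonneg: "0 \<le> \<rho>' t"
  using mono_on_imp_deriv_nonneg[of UNIV \<rho>, OF _ rho_deriv] rho_mono by simp

lemma rho_nonneg: "0 \<le> t \<Longrightarrow> 0 \<le> \<rho> t" and rho_nonpos: "t \<le> 0 \<Longrightarrow> \<rho> t \<le> 0"
  using rho_le[of 0 t] rho_le[of t 0] by auto

lemma rho_cont: "continuous_on X \<rho>"
  using rho_deriv by (auto intro!: continuous_at_imp_continuous_on DERIV_isCont)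

lemma rho_at_bot: "filterlim \<rho> at_bot at_bot"
proof -
  have "filterlim (\<lambda>t. - \<rho> (- t)) at_bot at_bot"
    using filterlim_compose[OF rho_at_top filterlim_uminus_at_top_at_bot]
    by (simp add: filterlim_uminus_at_bot)
  then show ?thesis by (simp add: rho_odd)
qed

text \<open>Also when \<open>\<rho>\<close> vanishes on an interval around \<open>0\<close>, \<open>\<bar>\<rho> t\<bar>\<close> equals \<open>sgn t * \<rho> t\<close>.\<close>

lemma abs_rho_deriv:
  assumes "t \<noteq> 0" shows "((\<lambda>t. \<bar>\<rho> t\<bar>) has_real_derivative sgn t * \<rho>' t) (at t)"
proof (cases "0 < t")
  case True
  have "(\<rho> has_real_derivative sgn t * \<rho>' t) (at t)"
    using rho_deriv[of t] True by simp
  then show ?thesis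
    by (rule has_field_derivative_transform_within_open[of _ _ _ "{0<..}"])
      (use True in \<open>auto simp: rho_nonneg\<close>)
next
  case False
  have "((\<lambda>t. - \<rho> t) has_real_derivative sgn t * \<rho>' t) (at t)"
    using DERIV_minus[OF rho_deriv[of t]] False assms by simp
  then show ?thesis
    by (rule has_field_derivative_transform_within_open[of _ _ _ "{..<0}"])
      (use False assms in \<open>auto simp: rho_nonpos\<close>)
qed

text \<open>For \<open>g > 0\<close>, a function with integral 1 over the line. It dominates \<open>D * exp (\<epsilon> * \<bar>\<rho> r\<bar>) * Lip (f r)\<close> up to the
  factor \<open>\<delta>\<close>, for \<open>g = \<gamma>\<close>.\<close>

definition bump :: "real \<Rightarrow> real \<Rightarrow> real" where
  "bump g t = g / 2 * \<rho>' t * exp (- g * \<bar>\<rho> t\<bar>)"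

text \<open>For \<open>g > 0\<close>, the antiderivative of \<open>bump\<close> with limits \<open>-1/2\<close> and \<open>1/2\<close>, that is
  \<open>sgn (\<rho> t) * (1 - exp (- g * \<bar>\<rho> t\<bar>)) / 2\<close>, in a form that is visibly continuous.\<close>

definition bump_primitive :: "real \<Rightarrow> real \<Rightarrow> real" where
  "bump_primitive g t = (exp (g * min (\<rho> t) 0) - exp (- g * max (\<rho> t) 0)) / 2"

lemma bump_primitive_cont: "continuous_on X (bump_primitive g)"
  unfolding bump_primitive_def by (intro continuous_intros rho_cont) auto

lemma bump_primitive_deriv:
  assumes "t \<noteq> 0" shows "(bump_primitive g has_real_derivative bump g t) (at t)"
proof (cases "0 < t")
  case True
  have "((\<lambda>t. (1 - exp (- g * \<rho> t)) / 2) has_real_derivative bump g t) (at t)"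
    using rho_nonneg[of t] True
    by (auto simp: bump_def intro!: derivative_eq_intros rho_deriv)
  then show ?thesis
    by (rule has_field_derivative_transform_within_open[of _ _ _ "{0<..}"])
      (use True in \<open>auto simp: bump_primitive_def rho_nonneg\<close>)
next
  case False
  have "((\<lambda>t. (exp (g * \<rho> t) - 1) / 2) has_real_derivative bump g t) (at t)"
    using rho_nonpos[of t] False
    by (auto simp: bump_def intro!: derivative_eq_intros rho_deriv)
  then show ?thesis
    by (rule has_field_derivative_transform_within_open[of _ _ _ "{..<0}"])
      (use False assms in \<open>auto simp: bump_primitive_def rho_nonpos\<close>)
qed

lemma bump_primitive_bounds:
  assumes "0 \<le> g" shows "\<bar>bump_primitive g t\<bar> \<le> 1 / 2"
proof -
  have half: "\<bar>(p - q) / 2\<bar> \<le> 1 / 2" if "0 < p" "p \<le> 1" "0 < q" "q \<le> 1" for p q :: real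
    using that by (simp add: abs_le_iff)
  show ?thesis
    unfolding bump_primitive_def using assms by (intro half) (auto simp: mult_nonneg_nonpos)
qed

end

section \<open>The trichotomy bounds\<close>

locale trichotomy_rates = growth_rate +
  fixes a b c d D \<epsilon> \<delta> \<gamma> :: real
  assumes D: "1 \<le> D" and eps: "0 \<le> \<epsilon>" and delta: "0 \<le> \<delta>" "\<delta> < 1 / 6" and gamma: "0 < \<gamma>"
    and gap_minus: "a + b + \<epsilon> < 0" and gap_plus: "c + d + \<epsilon> < 0"
begin

abbreviation "\<alpha> \<equiv> rho_alpha \<rho> D \<epsilon> a c"
abbreviation "\<beta>p \<equiv> rho_beta_plus \<rho> D \<epsilon> d"
abbreviation "\<beta>m \<equiv> rho_beta_minus \<rho> D \<epsilon> b"

text \<open>The bound imposed on the Lipschitz constant of \<open>f r\<close>.\<close>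

definition lip_bound :: "real \<Rightarrow> real" where
  "lip_bound r = \<delta> * \<rho>' r / (D\<^sup>2 * exp (2 * \<epsilon> * \<bar>\<rho> r\<bar>)) *
     min (min (- c - d - \<epsilon> * sgn r) (- a - b + \<epsilon> * sgn r)) (D * \<gamma> / 2 * exp ((\<epsilon> - \<gamma>) * \<bar>\<rho> r\<bar>))"

text \<open>Up to \<open>\<delta>\<close>, an antiderivative in \<open>r\<close> of the bound for \<open>\<beta>p s r * Lip (f r) * \<alpha> r s\<close>, normalized to 1 at
  \<open>r = s\<close>; \<open>- unstable_kernel\<close> plays the same role for \<open>\<beta>m\<close>.\<close>

definition stable_kernel :: "real \<Rightarrow> real \<Rightarrow> real" where
  "stable_kernel s r = exp ((c + d) * (\<rho> s - \<rho> r) + \<epsilon> * \<bar>\<rho> s\<bar> - \<epsilon> * \<bar>\<rho> r\<bar>)"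

definition unstable_kernel :: "real \<Rightarrow> real \<Rightarrow> real" where
  "unstable_kernel s r = exp ((a + b) * (\<rho> r - \<rho> s) + \<epsilon> * \<bar>\<rho> s\<bar> - \<epsilon> * \<bar>\<rho> r\<bar>)"

lemma eps_sgn: "\<bar>\<epsilon> * sgn r\<bar> \<le> \<epsilon>"
  using eps by (auto simp: sgn_if)

lemma lip_bound_factor_nonneg: "0 \<le> \<delta> * \<rho>' r / (D\<^sup>2 * exp (2 * \<epsilon> * \<bar>\<rho> r\<bar>))"
  using delta(1) rho'_nonneg[of r] by simp

lemma lip_bound_min_nonneg:
  "0 \<le> min (min (- c - d - \<epsilon> * sgn r) (- a - b + \<epsilon> * sgn r))
     (D * \<gamma> / 2 * exp ((\<epsilon> - \<gamma>) * \<bar>\<rho> r\<bar>))"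
  using eps_sgn[of r] gap_minus gap_plus D gamma by auto

lemma lip_bound_nonneg: "0 \<le> lip_bound r"
  unfolding lip_bound_def by (rule mult_nonneg_nonneg[OF lip_bound_factor_nonneg lip_bound_min_nonneg])

lemma lip_bound_le:
  assumes "min (min (- c - d - \<epsilon> * sgn r) (- a - b + \<epsilon> * sgn r))
     (D * \<gamma> / 2 * exp ((\<epsilon> - \<gamma>) * \<bar>\<rho> r\<bar>)) \<le> m"
  shows "D\<^sup>2 * exp (2 * \<epsilon> * \<bar>\<rho> r\<bar>) * lip_bound r \<le> \<delta> * \<rho>' r * m"
proof -
  have "lip_bound r \<le> \<delta> * \<rho>' r / (D\<^sup>2 * exp (2 * \<epsilon> * \<bar>\<rho> r\<bar>)) * m"
    unfolding lip_bound_def by (rule mult_left_mono[OF assms lip_bound_factor_nonneg])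
  then show ?thesis
    using D by (simp add: field_simps)
qed

text \<open>This is where the third term of the minimum is used.\<close>

lemma lip_bound_bump: "D * exp (\<epsilon> * \<bar>\<rho> r\<bar>) * lip_bound r \<le> \<delta> * bump \<gamma> r"
proof -
  define E where "E = exp (\<epsilon> * \<bar>\<rho> r\<bar>)"
  have E: "0 < E" "exp (2 * \<epsilon> * \<bar>\<rho> r\<bar>) = E * E"
    "exp ((\<epsilon> - \<gamma>) * \<bar>\<rho> r\<bar>) = E * exp (- \<gamma> * \<bar>\<rho> r\<bar>)"
    by (simp_all add: E_def left_diff_distrib flip: exp_add)
  have "D\<^sup>2 * (E * E) * lip_bound r
      \<le> \<delta> * \<rho>' r * (D * \<gamma> / 2 * (E * exp (- \<gamma> * \<bar>\<rho> r\<bar>)))"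
    using lip_bound_le[of r, OF min.cobounded2] unfolding E(2,3) .
  then have "(D * E) * (D * E * lip_bound r) \<le> (D * E) * (\<delta> * bump \<gamma> r)"
    by (simp only: bump_def power2_eq_square mult_ac times_divide_eq_left times_divide_eq_right)
  moreover have "0 < D * E" using D E by simp
  ultimately have "D * E * lip_bound r \<le> \<delta> * bump \<gamma> r"
    by (rule mult_left_le_imp_le)
  then show ?thesis by (simp add: E_def)
qed

lemma alpha_pos: "0 < \<alpha> t s"
  using D by (simp add: rho_alpha_def)

text \<open>The exponent of \<open>\<alpha> t s\<close> as a function of \<open>u = \<rho> t - \<rho> s\<close>, piecewise linear with slopes \<open>-c\<close> and \<open>a\<close>.\<close>

definition rate :: "real \<Rightarrow> real" where
  "rate u = a * max u 0 + c * max (- u) 0"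

lemma rate_lipschitz: "rate u \<le> (\<bar>a\<bar> + \<bar>c\<bar>) * \<bar>u - u'\<bar> + rate u'"
proof -
  have *: "x * y \<le> \<bar>x\<bar> * z" if "\<bar>y\<bar> \<le> z" for x y z :: real
    using mult_left_mono[OF that abs_ge_zero[of x]] abs_ge_self[of "x * y"] by (simp add: abs_mult)
  have "a * (max u 0 - max u' 0) \<le> \<bar>a\<bar> * \<bar>u - u'\<bar>"
    "c * (max (- u) 0 - max (- u') 0) \<le> \<bar>c\<bar> * \<bar>u - u'\<bar>"
    by (rule *; simp add: max_def abs_if)+
  then show ?thesis unfolding rate_def by (simp add: algebra_simps)
qed

lemma rate_add:
  assumes "0 \<le> u \<and> 0 \<le> v \<or> u \<le> 0 \<and> v \<le> 0"
  shows "rate u + rate v = rate (u + v)"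
  using assms by (auto simp: rate_def max_def algebra_simps)

text \<open>Both slopes of \<open>rate\<close> are at least \<open>d\<close>: the slope \<open>-c\<close> by the gap condition, the slope \<open>a\<close> by
  assumption. Dually, both are at most \<open>-b\<close> in the next lemma.\<close>

lemma rate_stable:
  assumes "d \<le> a" "0 \<le> u"
  shows "d * u + rate v \<le> rate (u + v)"
proof (cases "0 \<le> v")
  case True
  then show ?thesis
    using assms mult_right_mono[OF assms] by (simp add: rate_def max_absorb1 max_absorb2 algebra_simps)
next
  case v: False
  show ?thesis
  proof (cases "0 \<le> u + v")
    case True
    have "d * (u + v) \<le> a * (u + v)" using assms True by (simp add: mult_right_mono)
    moreover have "(c + d) * (- v) \<le> 0"
      using v gap_plus eps by (intro mult_nonpos_nonneg) auto
    ultimately show ?thesis using True v by (simp add: rate_def max_def algebra_simps)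
  next
    case False
    have "(c + d) * u \<le> 0"
      using assms gap_plus eps by (intro mult_nonpos_nonneg) auto
    then show ?thesis using False v by (simp add: rate_def max_def algebra_simps)
  qed
qed

lemma rate_unstable:
  assumes "b \<le> c" "0 \<le> u"
  shows "b * u + rate v \<le> rate (v - u)"
proof (cases "v \<le> 0")
  case True
  then show ?thesis
    using assms mult_right_mono[OF assms] by (simp add: rate_def max_def algebra_simps)
next
  case v: False
  show ?thesis
  proof (cases "v - u \<le> 0")
    case True
    have "b * (u - v) \<le> c * (u - v)" using assms True by (simp add: mult_right_mono)
    moreover have "(a + b) * v \<le> 0"
      using v gap_minus eps by (intro mult_nonpos_nonneg) auto
    ultimately show ?thesis using True v by (simp add: rate_def max_def algebra_simps)
  next
    case False
    have "(a + b) * u \<le> 0"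
      using assms gap_minus eps by (intro mult_nonpos_nonneg) auto
    then show ?thesis using False v by (simp add: rate_def max_def algebra_simps)
  qed
qed

lemma alpha_eq: "\<alpha> t s = D * exp (rate (\<rho> t - \<rho> s) + \<epsilon> * \<bar>\<rho> s\<bar>)"
proof (cases "s \<le> t")
  case True
  then show ?thesis using rho_le[OF True] by (simp add: rho_alpha_def rate_def max_def)
next
  case False
  then show ?thesis using rho_le[of t s] by (simp add: rho_alpha_def rate_def max_def)
qed

lemma alpha_cont: "continuous_on UNIV (\<lambda>t. \<alpha> t s)"
  unfolding alpha_eq rate_def by (intro continuous_intros rho_cont)

text \<open>The growth class of a function does not depend on the base time, because \<open>rate\<close> is Lipschitz.\<close>

lemma alpha_comparable: "\<exists>C\<ge>0. \<forall>t. \<alpha> t s \<le> C * \<alpha> t s'"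
proof -
  define C where "C = (\<bar>a\<bar> + \<bar>c\<bar>) * \<bar>\<rho> s' - \<rho> s\<bar> + \<epsilon> * \<bar>\<rho> s\<bar>"
  have "\<alpha> t s \<le> exp C * \<alpha> t s'" for t
  proof -
    have "0 \<le> \<epsilon> * \<bar>\<rho> s'\<bar>" using eps by simp
    then have "rate (\<rho> t - \<rho> s) + \<epsilon> * \<bar>\<rho> s\<bar> \<le> C + (rate (\<rho> t - \<rho> s') + \<epsilon> * \<bar>\<rho> s'\<bar>)"
      using rate_lipschitz[of "\<rho> t - \<rho> s" "\<rho> t - \<rho> s'"] by (simp add: C_def)
    then have "exp (rate (\<rho> t - \<rho> s) + \<epsilon> * \<bar>\<rho> s\<bar>)
        \<le> exp C * exp (rate (\<rho> t - \<rho> s') + \<epsilon> * \<bar>\<rho> s'\<bar>)"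
      by (simp flip: exp_add)
    then show ?thesis using D by (simp add: alpha_eq mult.left_commute)
  qed
  then show ?thesis by (intro exI[of _ "exp C"]) simp
qed

lemma exp_product_le:
  assumes "x + y \<le> z + w"
  shows "D * exp x * (D * exp y) \<le> D * exp z * (D * exp w)"
proof -
  have "exp x * exp y \<le> exp z * exp w" using assms by (simp flip: exp_add)
  then have "D * D * (exp x * exp y) \<le> D * D * (exp z * exp w)"
    using D by (intro mult_left_mono) auto
  then show ?thesis by (simp only: mult_ac)
qed

text \<open>With the next two lemmas, this says that composing a component of the evolution from \<open>r\<close> to \<open>t\<close> with
  growth \<open>\<alpha> r s\<close> costs only the factor \<open>D * exp (\<epsilon> * \<bar>\<rho> r\<bar>)\<close> over \<open>\<alpha> t s\<close>. It is needed for the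
  center component with \<open>r\<close> between \<open>s\<close> and \<open>t\<close>, for the stable one with \<open>r \<le> t\<close>, and for the
  unstable one with \<open>t \<le> r\<close>.\<close>

lemma alpha_between:
  assumes "r \<in> closed_segment s t"
  shows "\<alpha> t r * \<alpha> r s \<le> D * exp (\<epsilon> * \<bar>\<rho> r\<bar>) * \<alpha> t s"
proof -
  have "rate (\<rho> t - \<rho> r) + rate (\<rho> r - \<rho> s) = rate ((\<rho> t - \<rho> r) + (\<rho> r - \<rho> s))"
    using assms by (intro rate_add) (auto simp: closed_segment_eq_real_ivl rho_le split: if_splits)
  then show ?thesis unfolding alpha_eq by (intro exp_product_le) simp
qed

lemma beta_plus_alpha:
  assumes "d \<le> a" "r \<le> t"
  shows "\<beta>p t r * \<alpha> r s \<le> D * exp (\<epsilon> * \<bar>\<rho> r\<bar>) * \<alpha> t s"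
proof -
  have "d * (\<rho> t - \<rho> r) + rate (\<rho> r - \<rho> s) \<le> rate ((\<rho> t - \<rho> r) + (\<rho> r - \<rho> s))"
    using assms by (intro rate_stable) (auto simp: rho_le)
  then show ?thesis unfolding alpha_eq rho_beta_plus_def by (intro exp_product_le) simp
qed

lemma beta_minus_alpha:
  assumes "b \<le> c" "t \<le> r"
  shows "\<beta>m t r * \<alpha> r s \<le> D * exp (\<epsilon> * \<bar>\<rho> r\<bar>) * \<alpha> t s"
proof -
  have "b * (\<rho> r - \<rho> t) + rate (\<rho> r - \<rho> s) \<le> rate ((\<rho> r - \<rho> s) - (\<rho> r - \<rho> t))"
    using assms by (intro rate_unstable) (auto simp: rho_le)
  then show ?thesis unfolding alpha_eq rho_beta_minus_def by (intro exp_product_le) simp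
qed

lemma kernel_cont:
  "continuous_on X (stable_kernel s)" "continuous_on X (unstable_kernel s)"
  unfolding stable_kernel_def[abs_def] unstable_kernel_def[abs_def]
  by (intro continuous_intros rho_cont)+

lemma stable_kernel_deriv:
  assumes "r \<noteq> 0"
  shows "(stable_kernel s has_real_derivative
    (- c - d - \<epsilon> * sgn r) * \<rho>' r * stable_kernel s r) (at r)"
  unfolding stable_kernel_def[abs_def]
  by (auto intro!: derivative_eq_intros rho_deriv abs_rho_deriv assms simp: algebra_simps)

lemma unstable_kernel_deriv:
  assumes "r \<noteq> 0"
  shows "((\<lambda>r. - unstable_kernel s r) has_real_derivative
    (- a - b + \<epsilon> * sgn r) * \<rho>' r * unstable_kernel s r) (at r)"
  unfolding unstable_kernel_def[abs_def]
  by (auto intro!: derivative_eq_intros rho_deriv abs_rho_deriv assms simp: algebra_simps)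

text \<open>The first term of the minimum in \<open>lip_bound\<close> is the logarithmic derivative of \<open>stable_kernel\<close>
  divided by \<open>\<rho>'\<close>; up to sign, so is the second term for \<open>unstable_kernel\<close>.\<close>

lemma stable_kernel_bound:
  assumes "r \<le> s"
  shows "\<beta>p s r * lip_bound r * \<alpha> r s
    \<le> \<delta> * ((- c - d - \<epsilon> * sgn r) * \<rho>' r * stable_kernel s r)"
proof -
  have "\<beta>p s r * \<alpha> r s = D\<^sup>2 * exp (2 * \<epsilon> * \<bar>\<rho> r\<bar>) * stable_kernel s r"
  proof -
    have "rate (\<rho> r - \<rho> s) = c * (\<rho> s - \<rho> r)"
      using rho_le[OF assms] by (simp add: rate_def max_def)
    then have "(d * (\<rho> s - \<rho> r) + \<epsilon> * \<bar>\<rho> r\<bar>) + (rate (\<rho> r - \<rho> s) + \<epsilon> * \<bar>\<rho> s\<bar>)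
        = 2 * \<epsilon> * \<bar>\<rho> r\<bar> + ((c + d) * (\<rho> s - \<rho> r) + \<epsilon> * \<bar>\<rho> s\<bar> - \<epsilon> * \<bar>\<rho> r\<bar>)"
      by (simp add: algebra_simps)
    from arg_cong[OF this, of exp] show ?thesis
      unfolding rho_beta_plus_def alpha_eq stable_kernel_def exp_add power2_eq_square
      by (simp add: mult_ac)
  qed
  then have "\<beta>p s r * lip_bound r * \<alpha> r s
      = (D\<^sup>2 * exp (2 * \<epsilon> * \<bar>\<rho> r\<bar>) * lip_bound r) * stable_kernel s r"
    by (simp add: mult_ac)
  also have "\<dots> \<le> (\<delta> * \<rho>' r * (- c - d - \<epsilon> * sgn r)) * stable_kernel s r"
    by (intro mult_right_mono lip_bound_le) (auto simp: stable_kernel_def)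
  finally show ?thesis by (simp add: mult_ac)
qed

lemma unstable_kernel_bound:
  assumes "s \<le> r"
  shows "\<beta>m s r * lip_bound r * \<alpha> r s
    \<le> \<delta> * ((- a - b + \<epsilon> * sgn r) * \<rho>' r * unstable_kernel s r)"
proof -
  have "\<beta>m s r * \<alpha> r s = D\<^sup>2 * exp (2 * \<epsilon> * \<bar>\<rho> r\<bar>) * unstable_kernel s r"
  proof -
    have "rate (\<rho> r - \<rho> s) = a * (\<rho> r - \<rho> s)"
      using rho_le[OF assms] by (simp add: rate_def max_def)
    then have "(b * (\<rho> r - \<rho> s) + \<epsilon> * \<bar>\<rho> r\<bar>) + (rate (\<rho> r - \<rho> s) + \<epsilon> * \<bar>\<rho> s\<bar>)
        = 2 * \<epsilon> * \<bar>\<rho> r\<bar> + ((a + b) * (\<rho> r - \<rho> s) + \<epsilon> * \<bar>\<rho> s\<bar> - \<epsilon> * \<bar>\<rho> r\<bar>)"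
      by (simp add: algebra_simps)
    from arg_cong[OF this, of exp] show ?thesis
      unfolding rho_beta_minus_def alpha_eq unstable_kernel_def exp_add power2_eq_square
      by (simp add: mult_ac)
  qed
  then have "\<beta>m s r * lip_bound r * \<alpha> r s
      = (D\<^sup>2 * exp (2 * \<epsilon> * \<bar>\<rho> r\<bar>) * lip_bound r) * unstable_kernel s r"
    by (simp add: mult_ac)
  also have "\<dots> \<le> (\<delta> * \<rho>' r * (- a - b + \<epsilon> * sgn r)) * unstable_kernel s r"
    by (intro mult_right_mono lip_bound_le) (auto simp: unstable_kernel_def)
  finally show ?thesis by (simp add: mult_ac)
qed

lemma stable_kernel_at_bot: "(stable_kernel s \<longlongrightarrow> 0) at_bot"
proof -
  define k where "k = exp ((c + d) * \<rho> s + \<epsilon> * \<bar>\<rho> s\<bar>)"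
  have "0 < - (c + d)" using gap_plus eps by simp
  then have "filterlim (\<lambda>r. - (c + d) * \<rho> r) at_bot at_bot"
    by (intro filterlim_tendsto_pos_mult_at_bot[OF tendsto_const] rho_at_bot)
  then have "((\<lambda>r. exp (- (c + d) * \<rho> r)) \<longlongrightarrow> 0) at_bot"
    by (rule filterlim_compose[OF exp_at_bot])
  then have "((\<lambda>r. k * exp (- (c + d) * \<rho> r)) \<longlongrightarrow> 0) at_bot"
    by (rule tendsto_mult_right_zero)
  moreover have "norm (stable_kernel s r) \<le> k * exp (- (c + d) * \<rho> r)" for r
  proof -
    have "(c + d) * (\<rho> s - \<rho> r) + \<epsilon> * \<bar>\<rho> s\<bar> - \<epsilon> * \<bar>\<rho> r\<bar>
        \<le> ((c + d) * \<rho> s + \<epsilon> * \<bar>\<rho> s\<bar>) + - (c + d) * \<rho> r"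
      using eps mult_nonneg_nonneg[OF eps abs_ge_zero[of "\<rho> r"]] by (simp add: algebra_simps)
    then show ?thesis by (simp add: stable_kernel_def k_def flip: exp_add)
  qed
  ultimately show ?thesis
    by (rule Lim_null_comparison[rotated, OF _ always_eventually[rule_format]])
qed

lemma unstable_kernel_at_top: "(unstable_kernel s \<longlongrightarrow> 0) at_top"
proof -
  define k where "k = exp (- (a + b) * \<rho> s + \<epsilon> * \<bar>\<rho> s\<bar>)"
  have "a + b < 0" using gap_minus eps by simp
  then have "filterlim (\<lambda>r. (a + b) * \<rho> r) at_bot at_top"
    by (intro filterlim_tendsto_neg_mult_at_bot[OF tendsto_const] rho_at_top)
  then have "((\<lambda>r. exp ((a + b) * \<rho> r)) \<longlongrightarrow> 0) at_top"
    by (rule filterlim_compose[OF exp_at_bot])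
  then have "((\<lambda>r. k * exp ((a + b) * \<rho> r)) \<longlongrightarrow> 0) at_top"
    by (rule tendsto_mult_right_zero)
  moreover have "norm (unstable_kernel s r) \<le> k * exp ((a + b) * \<rho> r)" for r
  proof -
    have "(a + b) * (\<rho> r - \<rho> s) + \<epsilon> * \<bar>\<rho> s\<bar> - \<epsilon> * \<bar>\<rho> r\<bar>
        \<le> (- (a + b) * \<rho> s + \<epsilon> * \<bar>\<rho> s\<bar>) + (a + b) * \<rho> r"
      using eps mult_nonneg_nonneg[OF eps abs_ge_zero[of "\<rho> r"]] by (simp add: algebra_simps)
    then show ?thesis by (simp add: unstable_kernel_def k_def flip: exp_add)
  qed
  ultimately show ?thesis
    by (rule Lim_null_comparison[rotated, OF _ always_eventually[rule_format]])
qed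

lemma stable_integral:
  "(\<integral>\<^sup>+ r \<in> {..s}. ennreal (\<delta> * ((- c - d - \<epsilon> * sgn r) * \<rho>' r * stable_kernel s r)) \<partial>lborel)
    = ennreal \<delta>"
proof (rule nn_integral_derivative_exhaustion
    [where S = "{0}" and K = "\<lambda>r. \<delta> * stable_kernel s r" and p = "\<lambda>n. s - real n" and q = "\<lambda>_. s"])
  show "(\<Union>n. {s - real n..s}) = {..s}"
  proof safe
    fix r assume "r \<le> s"
    obtain n where "s - r \<le> real n" using real_arch_simple by blast
    with \<open>r \<le> s\<close> show "r \<in> (\<Union>n. {s - real n..s})" by (intro UN_I[of n]) auto
  qed auto
  have "filterlim (\<lambda>n. - s + real n) at_top sequentially"
    by (rule filterlim_tendsto_add_at_top[OF tendsto_const filterlim_real_sequentially])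
  then have "filterlim (\<lambda>n. s - real n) at_bot sequentially"
    by (simp add: filterlim_uminus_at_bot)
  then have "(\<lambda>n. stable_kernel s (s - real n)) \<longlonglongrightarrow> 0"
    by (rule filterlim_compose[OF stable_kernel_at_bot])
  then have "(\<lambda>n. \<delta> * stable_kernel s s - \<delta> * stable_kernel s (s - real n))
      \<longlonglongrightarrow> \<delta> * stable_kernel s s - \<delta> * 0"
    by (intro tendsto_intros)
  then show "(\<lambda>n. \<delta> * stable_kernel s s - \<delta> * stable_kernel s (s - real n)) \<longlonglongrightarrow> \<delta>"
    by (simp add: stable_kernel_def)
  show "((\<lambda>r. \<delta> * stable_kernel s r) has_real_derivative
      \<delta> * ((- c - d - \<epsilon> * sgn r) * \<rho>' r * stable_kernel s r)) (at r)" if "r \<notin> {0}" for r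
    using that by (intro DERIV_cmult stable_kernel_deriv) simp
  show "0 \<le> \<delta> * ((- c - d - \<epsilon> * sgn r) * \<rho>' r * stable_kernel s r)" for r
    using eps_sgn[of r] gap_plus delta rho'_nonneg[of r]
    by (intro mult_nonneg_nonneg) (auto simp: stable_kernel_def)
  show "continuous_on UNIV (\<lambda>r. \<delta> * stable_kernel s r)"
    by (intro continuous_intros kernel_cont)
qed auto

lemma unstable_integral:
  "(\<integral>\<^sup>+ r \<in> {s..}. ennreal (\<delta> * ((- a - b + \<epsilon> * sgn r) * \<rho>' r * unstable_kernel s r)) \<partial>lborel)
    = ennreal \<delta>"
proof (rule nn_integral_derivative_exhaustion
    [where S = "{0}" and K = "\<lambda>r. \<delta> * - unstable_kernel s r" and p = "\<lambda>_. s" and q = "\<lambda>n. s + real n"])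
  show "(\<Union>n. {s..s + real n}) = {s..}"
  proof safe
    fix r assume "s \<le> r"
    obtain n where "r - s \<le> real n" using real_arch_simple by blast
    with \<open>s \<le> r\<close> show "r \<in> (\<Union>n. {s..s + real n})" by (intro UN_I[of n]) auto
  qed auto
  have "filterlim (\<lambda>n. s + real n) at_top sequentially"
    by (rule filterlim_tendsto_add_at_top[OF tendsto_const filterlim_real_sequentially])
  then have "(\<lambda>n. unstable_kernel s (s + real n)) \<longlonglongrightarrow> 0"
    by (rule filterlim_compose[OF unstable_kernel_at_top])
  then have "(\<lambda>n. \<delta> * - unstable_kernel s (s + real n) - \<delta> * - unstable_kernel s s)
      \<longlonglongrightarrow> \<delta> * - 0 - \<delta> * - unstable_kernel s s"
    by (intro tendsto_intros)
  then show "(\<lambda>n. \<delta> * - unstable_kernel s (s + real n) - \<delta> * - unstable_kernel s s) \<longlonglongrightarrow> \<delta>"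
    by (simp add: unstable_kernel_def)
  show "((\<lambda>r. \<delta> * - unstable_kernel s r) has_real_derivative
      \<delta> * ((- a - b + \<epsilon> * sgn r) * \<rho>' r * unstable_kernel s r)) (at r)" if "r \<notin> {0}" for r
    using that by (intro DERIV_cmult unstable_kernel_deriv) simp
  show "0 \<le> \<delta> * ((- a - b + \<epsilon> * sgn r) * \<rho>' r * unstable_kernel s r)" for r
    using eps_sgn[of r] gap_minus delta rho'_nonneg[of r]
    by (intro mult_nonneg_nonneg) (auto simp: unstable_kernel_def)
  show "continuous_on UNIV (\<lambda>r. \<delta> * - unstable_kernel s r)"
    by (intro continuous_intros kernel_cont)
qed auto

text \<open>Each of the two integrals in \<open>\<omega>\<close> is dominated by that of an exact derivative, with value \<open>\<delta>\<close>. The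
  point \<open>r = 0\<close>, where the bound on \<open>Lip (f r)\<close> is not available, is a null set.\<close>

lemma omega_le:
  assumes Lip: "\<And>r. r \<noteq> 0 \<Longrightarrow> Lip (f r) \<le> ennreal (lip_bound r)"
  shows "omega_const \<alpha> \<beta>p \<beta>m f \<le> ennreal (2 * \<delta>)"
proof -
  have ae: "AE r in lborel. r \<noteq> (0::real)"
    by (rule AE_lborel_singleton)
  have product: "ennreal x * Lip (f r) * ennreal y \<le> ennreal z"
    if "r \<noteq> 0" "x * lip_bound r * y \<le> z" "0 \<le> x" "0 \<le> y" for x y z r
  proof -
    have "ennreal x * Lip (f r) * ennreal y \<le> ennreal x * ennreal (lip_bound r) * ennreal y"
      by (intro mult_right_mono mult_left_mono Lip that) auto
    also have "\<dots> = ennreal (x * lip_bound r * y)"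
      using that lip_bound_nonneg[of r] by (simp add: ennreal_mult)
    also have "\<dots> \<le> ennreal z" by (rule ennreal_leI[OF that(2)])
    finally show ?thesis .
  qed
  have beta: "0 \<le> \<beta>p s r" "0 \<le> \<beta>m s r" for s r
    using D by (simp_all add: rho_beta_plus_def rho_beta_minus_def)
  have "(\<integral>\<^sup>+ r \<in> {..s}. ennreal (\<beta>p s r) * Lip (f r) * ennreal (\<alpha> r s) \<partial>lborel) \<le> ennreal \<delta>" for s
    unfolding stable_integral[of s, symmetric]
    by (rule nn_integral_mono_AE)
      (use ae in eventually_elim, auto split: split_indicator
        intro!: product stable_kernel_bound beta less_imp_le[OF alpha_pos])
  moreover have "(\<integral>\<^sup>+ r \<in> {s..}. ennreal (\<beta>m s r) * Lip (f r) * ennreal (\<alpha> r s) \<partial>lborel) \<le> ennreal \<delta>" for s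
    unfolding unstable_integral[of s, symmetric]
    by (rule nn_integral_mono_AE)
      (use ae in eventually_elim, auto split: split_indicator
        intro!: product unstable_kernel_bound beta less_imp_le[OF alpha_pos])
  ultimately have "(\<integral>\<^sup>+ r \<in> {..s}. ennreal (\<beta>p s r) * Lip (f r) * ennreal (\<alpha> r s) \<partial>lborel)
      + (\<integral>\<^sup>+ r \<in> {s..}. ennreal (\<beta>m s r) * Lip (f r) * ennreal (\<alpha> r s) \<partial>lborel)
      \<le> ennreal \<delta> + ennreal \<delta>" for s
    by (intro add_mono)
  also have "ennreal \<delta> + ennreal \<delta> = ennreal (2 * \<delta>)"
    using delta by (simp flip: ennreal_plus)
  finally show ?thesis
    unfolding omega_const_def by (intro SUP_least)
qed

end

section \<open>Limits forced by bounded increments\<close>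

text \<open>The increments of \<open>z\<close> are controlled by those of a monotone bounded function, so \<open>z\<close> is Cauchy. It is the
  counterpart of the convergence of an improper integral with integrable majorant.\<close>

lemma convergent_at_bot_of_dominated_increments:
  fixes z :: "real \<Rightarrow> 'a::banach" and K :: "real \<Rightarrow> real"
  assumes incr: "\<And>p q. p \<le> q \<Longrightarrow> q \<le> t \<Longrightarrow> norm (z q - z p) \<le> K q - K p"
    and K: "\<And>p. m \<le> K p"
  shows "\<exists>l. (z \<longlongrightarrow> l) at_bot"
proof -
  have "cauchy_filter (filtermap z at_bot)"
    unfolding cauchy_filter_metric_filtermap
  proof safe
    fix e :: real assume e: "0 < e"
    define i where "i = (INF p\<in>{..t}. K p)"
    have bdd: "bdd_below (K ` {..t})" using K by (intro bdd_belowI[of _ m]) auto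
    then have lower: "i \<le> K p" if "p \<le> t" for p
      unfolding i_def using that by (intro cINF_lower) auto
    have "\<exists>x\<in>K ` {..t}. x < i + e"
      using e bdd unfolding i_def by (subst cInf_less_iff[symmetric]) auto
    then obtain p\<^sub>0 where p\<^sub>0: "p\<^sub>0 \<le> t" "K p\<^sub>0 < i + e" by auto
    have close: "dist (z q) (z p) < e" if "p \<le> q" "q \<le> p\<^sub>0" for p q
    proof -
      have "norm (z q - z p) \<le> K q - K p" using incr that p\<^sub>0 by simp
      moreover have "0 \<le> K p\<^sub>0 - K q"
        using incr[of q p\<^sub>0] that p\<^sub>0 norm_ge_zero order_trans by blast
      moreover have "i \<le> K p" using lower that p\<^sub>0 by simp
      ultimately show ?thesis using p\<^sub>0 by (simp add: dist_norm)
    qed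
    have "dist (z q) (z p) < e" if "p \<le> p\<^sub>0" "q \<le> p\<^sub>0" for p q
      using close[of p q] close[of q p] that by (cases "p \<le> q") (auto simp: dist_commute)
    then show "\<exists>P. eventually P at_bot \<and> (\<forall>x y. P x \<and> P y \<longrightarrow> dist (z x) (z y) < e)"
      by (intro exI[of _ "\<lambda>p. p \<le> p\<^sub>0"]) (auto simp: eventually_le_at_bot)
  qed
  then obtain l where "filtermap z at_bot \<le> nhds l"
    using cauchy_filter_complete_converges[OF _ complete_UNIV, of "filtermap z at_bot"]
    by (auto simp: filtermap_bot_iff)
  then show ?thesis unfolding filterlim_def by blast
qed

lemma convergent_at_top_of_dominated_increments:
  fixes z :: "real \<Rightarrow> 'a::banach" and K :: "real \<Rightarrow> real"
  assumes incr: "\<And>p q. p \<le> q \<Longrightarrow> t \<le> p \<Longrightarrow> norm (z q - z p) \<le> K q - K p"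
    and K: "\<And>p. K p \<le> m"
  shows "\<exists>l. (z \<longlongrightarrow> l) at_top"
proof -
  have "\<exists>l. ((\<lambda>r. z (- r)) \<longlongrightarrow> l) at_bot"
  proof (rule convergent_at_bot_of_dominated_increments)
    show "norm (z (- q) - z (- p)) \<le> - K (- q) - - K (- p)" if "p \<le> q" "q \<le> - t" for p q
      using incr[of "- q" "- p"] that by (simp add: norm_minus_commute)
    show "- m \<le> - K (- p)" for p using K by simp
  qed
  then show ?thesis by (simp add: filterlim_at_top_mirror)
qed

section \<open>The perturbed equation\<close>

locale perturbed_trichotomy = trichotomy_rates \<rho> \<rho>' a b c d D \<epsilon> \<delta> \<gamma> + linear_evolution A T
  for \<rho> \<rho>' a b c d D \<epsilon> \<delta> \<gamma> and A :: "real \<Rightarrow> 'a::banach \<Rightarrow>\<^sub>L 'a" and T +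
  fixes P Qp Qm :: "real \<Rightarrow> 'a \<Rightarrow>\<^sub>L 'a" and f :: "real \<Rightarrow> 'a \<Rightarrow> 'a"
  assumes trichotomy: "generalized_trichotomy T P Qp Qm \<alpha> \<beta>p \<beta>m"
    and f_cont: "continuous_on UNIV (\<lambda>(t, x). f t x)"
    and f_zero: "\<And>t. f t 0 = 0"
    and f_lip: "\<And>t x y. t \<noteq> 0 \<Longrightarrow> norm (f t x - f t y) \<le> lip_bound t * norm (x - y)"
begin

lemma splitting: "invariant_splitting T P Qp Qm"
  using trichotomy by (simp add: generalized_trichotomy_def)

lemma T_P_norm: "norm (T t s o\<^sub>L P s) \<le> \<alpha> t s"
  and T_Qp_norm: "s \<le> t \<Longrightarrow> norm (T t s o\<^sub>L Qp s) \<le> \<beta>p t s"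
  and T_Qm_norm: "t \<le> s \<Longrightarrow> norm (T t s o\<^sub>L Qm s) \<le> \<beta>m t s"
  using trichotomy by (auto simp: generalized_trichotomy_def)

lemma decomposition: "P t x + Qp t x + Qm t x = x"
proof -
  have "P t + Qp t + Qm t = id_blinfun"
    using splitting by (simp add: invariant_splitting_def)
  then have "(P t + Qp t + Qm t) x = x" by simp
  then show ?thesis by (simp add: blinfun.add_left)
qed

lemma Qm_eq: "Qm t x = x - P t x - Qp t x"
  using decomposition[of t x] by (simp add: algebra_simps)

lemma P_T: "P t (T t s x) = T t s (P s x)"
  and Qp_T: "Qp t (T t s x) = T t s (Qp s x)"
proof -
  have "P t o\<^sub>L T t s = T t s o\<^sub>L P s" "Qp t o\<^sub>L T t s = T t s o\<^sub>L Qp s"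
    using splitting by (simp_all add: invariant_splitting_def)
  from this[THEN arg_cong, of "\<lambda>B. B x"]
  show "P t (T t s x) = T t s (P s x)" "Qp t (T t s x) = T t s (Qp s x)" by simp_all
qed

lemma Qm_T: "Qm t (T t s x) = T t s (Qm s x)"
  by (simp add: Qm_eq P_T Qp_T blinfun.diff_right)

lemma P_P [simp]: "P t (P t x) = P t x" and Qp_Qp [simp]: "Qp t (Qp t x) = Qp t x"
  and Qm_Qm [simp]: "Qm t (Qm t x) = Qm t x" and P_Qp [simp]: "P t (Qp t x) = 0"
proof -
  have "P t o\<^sub>L P t = P t" "Qp t o\<^sub>L Qp t = Qp t" "Qm t o\<^sub>L Qm t = Qm t" "P t o\<^sub>L Qp t = 0"
    using splitting by (simp_all add: invariant_splitting_def)
  from this[THEN arg_cong, of "\<lambda>B. B x"]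
  show "P t (P t x) = P t x" "Qp t (Qp t x) = Qp t x" "Qm t (Qm t x) = Qm t x" "P t (Qp t x) = 0"
    by simp_all
qed

lemma P_Qm [simp]: "P t (Qm t x) = 0" and Qm_Qp [simp]: "Qm t (Qp t x) = 0"
  by (simp_all add: Qm_eq[of t x] Qm_eq[of t "Qp t x"] blinfun.diff_right)

text \<open>Multiplying \<open>Qm = id - P - Qp\<close> from the left by the idempotent \<open>Qm\<close> leaves \<open>Qm P = - Qm Qp = 0\<close>; then
  \<open>Qp P = P - P\<^sup>2 - Qm P = 0\<close>.\<close>

lemma Qm_P [simp]: "Qm t (P t x) = 0" and Qp_P [simp]: "Qp t (P t x) = 0"
  and Qp_Qm [simp]: "Qp t (Qm t x) = 0"
proof -
  have "Qm t (Qm t x) = Qm t x - Qm t (P t x) - Qm t (Qp t x)"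
    by (subst Qm_eq[of t x]) (simp add: blinfun.diff_right)
  then show "Qm t (P t x) = 0" by simp
  then show *: "Qp t (P t x) = 0" by (simp add: Qm_eq)
  show "Qp t (Qm t x) = 0"
    by (subst Qm_eq) (simp add: blinfun.diff_right *)
qed

lemma P_cont: "continuous_on X P"
proof -
  have "P t = T t 0 o\<^sub>L (P 0 o\<^sub>L T 0 t)" for t
    by (rule blinfun_eqI) (simp add: P_T)
  then have eq: "P = (\<lambda>t. T t 0 o\<^sub>L (P 0 o\<^sub>L T 0 t))" by (rule ext)
  show ?thesis
    by (subst eq, intro bounded_bilinear.continuous_on[OF bounded_bilinear_blinfun_compose] T_cont
        continuous_on_const)
qed

abbreviation rhs :: "real \<Rightarrow> 'a \<Rightarrow> 'a" where "rhs \<equiv> \<lambda>t x. A t x + f t x"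

lemma lip_bound_le_bump: "lip_bound r \<le> \<delta> * bump \<gamma> r"
proof -
  have "1 * 1 \<le> D * exp (\<epsilon> * \<bar>\<rho> r\<bar>)"
    using D eps by (intro mult_mono) auto
  then have "lip_bound r \<le> D * exp (\<epsilon> * \<bar>\<rho> r\<bar>) * lip_bound r"
    using lip_bound_nonneg[of r] mult_right_mono[of 1 "D * exp (\<epsilon> * \<bar>\<rho> r\<bar>)" "lip_bound r"] by simp
  then show ?thesis using lip_bound_bump[of r] by simp
qed

text \<open>The Lipschitz constant \<open>norm (A t) + \<delta> * bump \<gamma> t\<close> has an explicit antiderivative off \<open>t = 0\<close>.\<close>

lemma rhs_lipschitz: "\<exists>L. lipschitz_ode rhs L (\<lambda>t. norm (A t) + \<delta> * bump \<gamma> t) {0}"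
proof -
  obtain L where L: "\<And>t. (L has_real_derivative norm (A t)) (at t)"
    by (rule norm_A_antiderivative) blast
  have "lipschitz_ode rhs (\<lambda>t. L t + \<delta> * bump_primitive \<gamma> t) (\<lambda>t. norm (A t) + \<delta> * bump \<gamma> t) {0}"
  proof
    have "continuous_on UNIV (\<lambda>z :: real \<times> 'a. A (fst z))"
      by (rule continuous_on_compose2[OF A_cont]) (auto intro!: continuous_intros)
    then have "continuous_on UNIV (\<lambda>z. A (fst z) (snd z) + (case z of (t, x) \<Rightarrow> f t x))"
      by (intro continuous_on_add f_cont bounded_bilinear.continuous_on[OF bounded_bilinear_blinfun_apply])
        (auto intro!: continuous_intros)
    then show "continuous_on UNIV (\<lambda>(t, x). rhs t x)" by (simp add: case_prod_beta)
    show "norm (rhs t x - rhs t y) \<le> (norm (A t) + \<delta> * bump \<gamma> t) * norm (x - y)"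
      if "t \<notin> {0}" for t x y
    proof -
      have "norm (rhs t x - rhs t y) \<le> norm (A t (x - y)) + norm (f t x - f t y)"
        using norm_triangle_ineq[of "A t (x - y)" "f t x - f t y"]
        by (simp add: blinfun.diff_right algebra_simps)
      also have "norm (A t (x - y)) \<le> norm (A t) * norm (x - y)" by (rule norm_blinfun)
      also have "norm (f t x - f t y) \<le> lip_bound t * norm (x - y)" using f_lip that by simp
      also have "\<dots> \<le> \<delta> * bump \<gamma> t * norm (x - y)"
        by (intro mult_right_mono lip_bound_le_bump) simp
      finally show ?thesis by (simp add: algebra_simps)
    qed
    have "continuous_on UNIV L"
      using L by (intro continuous_at_imp_continuous_on) (auto intro: DERIV_isCont)
    then show "continuous_on UNIV (\<lambda>t. L t + \<delta> * bump_primitive \<gamma> t)"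
      by (intro continuous_intros bump_primitive_cont)
    show "((\<lambda>t. L t + \<delta> * bump_primitive \<gamma> t) has_real_derivative norm (A t) + \<delta> * bump \<gamma> t) (at t)"
      if "t \<notin> {0}" for t
      using that by (intro DERIV_add DERIV_cmult L bump_primitive_deriv) simp
    show "0 \<le> norm (A t) + \<delta> * bump \<gamma> t" for t
      using order_trans[OF lip_bound_nonneg lip_bound_le_bump[of t]] by simp
  qed (simp_all add: f_zero blinfun.zero_right)
  then show ?thesis by blast
qed

lemma perturbed_solution_unique:
  assumes "ode_solution rhs v" "ode_solution rhs w" "v s = w s"
  shows "v = w"
proof -
  obtain L where "lipschitz_ode rhs L (\<lambda>t. norm (A t) + \<delta> * bump \<gamma> t) {0}"
    using rhs_lipschitz by blast
  then show ?thesis using assms by (rule lipschitz_ode.unique_solution)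
qed

lemma perturbed_solution_exists: "\<exists>v. ode_solution rhs v \<and> v s = x"
proof -
  obtain L where "lipschitz_ode rhs L (\<lambda>t. norm (A t) + \<delta> * bump \<gamma> t) {0}"
    using rhs_lipschitz by blast
  then show ?thesis by (rule lipschitz_ode.solution_exists)
qed

lemma ivp_solution_eq:
  assumes "ode_solution rhs v" shows "ivp_solution A f s (v s) = v"
  unfolding ivp_solution_def
proof (rule the_equality)
  show "w = v" if "ode_solution rhs w \<and> w s = v s" for w
    using that assms by (intro perturbed_solution_unique[of w v s]) auto
qed (use assms in simp)

lemma flow_map_eq:
  assumes "ode_solution rhs v" shows "flow_map A f \<tau> (s, v s) = (s + \<tau>, v (s + \<tau>))"
  using assms by (simp add: flow_map_def ivp_solution_eq)

lemma zero_solution: "ode_solution rhs (\<lambda>_. 0)"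
  by (simp add: ode_solution_def f_zero blinfun.zero_right)

end

section \<open>Inhomogeneous equations with slow growth\<close>

locale central_trichotomy = perturbed_trichotomy +
  assumes P_nonzero: "P 0 \<noteq> 0"
begin

text \<open>A nonzero projection has norm at least 1, but \<open>norm (P 0) \<le> \<alpha> 0 t * \<alpha> t 0 = D\<^sup>2 * exp ((a + c + \<epsilon>) * \<rho> t)\<close>
  for \<open>t \<ge> 0\<close>.\<close>

lemma growth_decay_conflict: "0 \<le> a + c + \<epsilon>"
proof (rule ccontr)
  assume "\<not> 0 \<le> a + c + \<epsilon>"
  then have "filterlim (\<lambda>t. (a + c + \<epsilon>) * \<rho> t) at_bot at_top"
    by (intro filterlim_tendsto_neg_mult_at_bot[OF tendsto_const] rho_at_top) simp
  then have "((\<lambda>t. exp ((a + c + \<epsilon>) * \<rho> t)) \<longlongrightarrow> 0) at_top"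
    by (rule filterlim_compose[OF exp_at_bot])
  then have "((\<lambda>t. D\<^sup>2 * exp ((a + c + \<epsilon>) * \<rho> t)) \<longlongrightarrow> 0) at_top"
    by (rule tendsto_mult_right_zero)
  then have "\<forall>\<^sub>F t in at_top. D\<^sup>2 * exp ((a + c + \<epsilon>) * \<rho> t) < 1"
    by (rule order_tendstoD) simp
  then have "\<forall>\<^sub>F t in at_top. D\<^sup>2 * exp ((a + c + \<epsilon>) * \<rho> t) < 1 \<and> 0 \<le> t"
    using eventually_ge_at_top by (rule eventually_conj)
  then obtain t where t: "D\<^sup>2 * exp ((a + c + \<epsilon>) * \<rho> t) < 1" "0 \<le> t"
    using eventually_happens trivial_limit_at_top_linorder by blast
  have "P 0 o\<^sub>L P 0 = P 0" by (rule blinfun_eqI) simp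
  then have "norm (P 0) * 1 \<le> norm (P 0) * norm (P 0)"
    using norm_blinfun_compose[of "P 0" "P 0"] by simp
  then have "1 \<le> norm (P 0)"
    using P_nonzero mult_le_cancel_left_pos[of "norm (P 0)" 1 "norm (P 0)"] by simp
  also have "(T 0 t o\<^sub>L P t) o\<^sub>L (T t 0 o\<^sub>L P 0) = P 0"
    by (rule blinfun_eqI) (simp add: P_T)
  then have "norm (P 0) \<le> norm (T 0 t o\<^sub>L P t) * norm (T t 0 o\<^sub>L P 0)"
    using norm_blinfun_compose[of "T 0 t o\<^sub>L P t" "T t 0 o\<^sub>L P 0"] by simp
  also have "\<dots> \<le> \<alpha> 0 t * \<alpha> t 0"
    by (intro mult_mono T_P_norm order_trans[OF norm_ge_zero T_P_norm] norm_ge_zero)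
  also have "\<dots> = D\<^sup>2 * exp ((a + c + \<epsilon>) * \<rho> t)"
    using t(2) rho_nonneg[OF t(2)]
    by (simp add: alpha_eq rate_def power2_eq_square max_absorb1 max_absorb2 distrib_right exp_add)
  finally show False using t by simp
qed

lemma d_le_a: "d \<le> a" and b_le_c: "b \<le> c"
  using growth_decay_conflict gap_minus gap_plus by linarith+

text \<open>For \<open>y t = T 0 t (u t)\<close> this is the boundary condition that singles out the slowly growing \<open>u\<close>.
  It replaces the improper integrals of the Lyapunov-Perron equation.\<close>

definition tame :: "(real \<Rightarrow> 'a) \<Rightarrow> bool" where
  "tame y \<longleftrightarrow> ((\<lambda>r. Qp 0 (y r)) \<longlongrightarrow> 0) at_bot \<and> ((\<lambda>r. Qm 0 (y r)) \<longlongrightarrow> 0) at_top"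

lemma tame_diff:
  assumes "tame y" "tame z" shows "tame (\<lambda>r. y r - z r)"
  using assms tendsto_diff[of "\<lambda>r. Qp 0 (y r)" 0 at_bot "\<lambda>r. Qp 0 (z r)" 0]
    tendsto_diff[of "\<lambda>r. Qm 0 (y r)" 0 at_top "\<lambda>r. Qm 0 (z r)" 0]
  by (simp add: tame_def blinfun.diff_right)

text \<open>\<open>norm (Qp 0 (y r)) \<le> \<beta>p 0 r * K * \<alpha> r 0\<close>, which is \<open>K * D\<^sup>2 * exp (- (c + d + \<epsilon>) * \<rho> r)\<close> for \<open>r \<le> 0\<close>;
  here the gap conditions enter with the full \<open>\<epsilon>\<close>.\<close>

lemma tame_of_growth:
  assumes "\<And>t. norm (T t 0 (y t)) \<le> K * \<alpha> t 0"
  shows "tame y"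
proof -
  have K: "0 \<le> K"
    using order_trans[OF norm_ge_zero assms[of 0]] alpha_pos[of 0 0] by (simp add: zero_le_mult_iff)
  have component: "norm (Q 0 (y r)) \<le> K * (n * \<alpha> r 0)"
    if "norm (T 0 r o\<^sub>L Q r) \<le> n" "\<And>x. Q 0 (T 0 r x) = T 0 r (Q r x)"
    for Q :: "real \<Rightarrow> 'a \<Rightarrow>\<^sub>L 'a" and n r
  proof -
    have "Q 0 (y r) = (T 0 r o\<^sub>L Q r) (T r 0 (y r))" using that(2)[of "T r 0 (y r)"] by simp
    also have "norm \<dots> \<le> n * (K * \<alpha> r 0)"
      by (rule order_trans[OF norm_blinfun mult_mono[OF that(1) assms]])
        (use order_trans[OF norm_ge_zero that(1)] in auto)
    finally show ?thesis by (simp add: mult_ac)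
  qed
  have "((\<lambda>r. exp (- (c + d + \<epsilon>) * \<rho> r)) \<longlongrightarrow> 0) at_bot"
    using gap_plus
    by (intro filterlim_compose[OF exp_at_bot] filterlim_tendsto_pos_mult_at_bot[OF tendsto_const]
        rho_at_bot) simp
  then have "((\<lambda>r. K * (D\<^sup>2 * exp (- (c + d + \<epsilon>) * \<rho> r))) \<longlongrightarrow> 0) at_bot"
    by (intro tendsto_mult_right_zero)
  moreover have "\<forall>\<^sub>F r in at_bot. norm (Qp 0 (y r)) \<le> K * (D\<^sup>2 * exp (- (c + d + \<epsilon>) * \<rho> r))"
    using eventually_le_at_bot[of 0]
  proof eventually_elim
    case (elim r)
    have "\<beta>p 0 r * \<alpha> r 0 = D\<^sup>2 * exp (- (c + d + \<epsilon>) * \<rho> r)"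
      using rho_nonpos[OF elim]
      by (simp add: alpha_eq rho_beta_plus_def rate_def power2_eq_square max_absorb1 max_absorb2
          algebra_simps flip: exp_add)
    then show ?case using component[OF T_Qp_norm[OF elim] Qp_T] by metis
  qed
  ultimately have Qp: "((\<lambda>r. Qp 0 (y r)) \<longlongrightarrow> 0) at_bot"
    by (rule Lim_null_comparison[rotated])
  have "((\<lambda>r. exp ((a + b + \<epsilon>) * \<rho> r)) \<longlongrightarrow> 0) at_top"
    using gap_minus
    by (intro filterlim_compose[OF exp_at_bot] filterlim_tendsto_neg_mult_at_bot[OF tendsto_const]
        rho_at_top) simp
  then have "((\<lambda>r. K * (D\<^sup>2 * exp ((a + b + \<epsilon>) * \<rho> r))) \<longlongrightarrow> 0) at_top"
    by (intro tendsto_mult_right_zero)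
  moreover have "\<forall>\<^sub>F r in at_top. norm (Qm 0 (y r)) \<le> K * (D\<^sup>2 * exp ((a + b + \<epsilon>) * \<rho> r))"
    using eventually_ge_at_top[of 0]
  proof eventually_elim
    case (elim r)
    have "\<beta>m 0 r * \<alpha> r 0 = D\<^sup>2 * exp ((a + b + \<epsilon>) * \<rho> r)"
      using rho_nonneg[OF elim]
      by (simp add: alpha_eq rho_beta_minus_def rate_def power2_eq_square max_absorb1 max_absorb2
          algebra_simps flip: exp_add)
    then show ?case using component[OF T_Qm_norm[OF elim] Qm_T] by metis
  qed
  ultimately have "((\<lambda>r. Qm 0 (y r)) \<longlongrightarrow> 0) at_top"
    by (rule Lim_null_comparison[rotated])
  with Qp show ?thesis by (simp add: tame_def)
qed

end

lemma norm_le_of_tendsto_zero: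
  fixes B :: "'a::real_normed_vector \<Rightarrow>\<^sub>L 'b::real_normed_vector"
  assumes "(z \<longlongrightarrow> 0) G" "G \<noteq> bot" "\<forall>\<^sub>F p in G. norm (B (x - z p)) \<le> C"
  shows "norm (B x) \<le> C"
proof -
  have "((\<lambda>p. norm (B (x - z p))) \<longlongrightarrow> norm (B (x - 0))) G"
    by (intro tendsto_intros assms(1))
  from tendsto_upperbound[OF this assms(3,2)] show ?thesis by simp
qed

context central_trichotomy
begin

text \<open>By variation of constants, \<open>T t 0 (y t)\<close> then solves \<open>u' = A u + F\<close>.\<close>

definition mild :: "(real \<Rightarrow> 'a) \<Rightarrow> (real \<Rightarrow> 'a) \<Rightarrow> bool" where
  "mild F y \<longleftrightarrow> (\<forall>t. (y has_vector_derivative T 0 t (F t)) (at t))"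

text \<open>The size of \<open>F r = f r (v r) - f r (w r)\<close> when \<open>norm (v r - w r) \<le> M * \<alpha> r s\<close>.\<close>

definition dominated :: "real \<Rightarrow> real \<Rightarrow> (real \<Rightarrow> 'a) \<Rightarrow> bool" where
  "dominated s M F \<longleftrightarrow> 0 \<le> M \<and> (\<forall>r. r \<noteq> 0 \<longrightarrow> norm (F r) \<le> lip_bound r * (M * \<alpha> r s))"

lemma component_increment:
  fixes B :: "'a \<Rightarrow>\<^sub>L 'a"
  assumes y: "mild F y" and pq: "p \<le> q" and K: "continuous_on UNIV K"
    "\<And>r. r \<noteq> 0 \<Longrightarrow> (K has_real_derivative k r) (at r)"
    and bound: "\<And>r. p \<le> r \<Longrightarrow> r \<le> q \<Longrightarrow> r \<noteq> 0 \<Longrightarrow> norm (B (T 0 r (F r))) \<le> k r"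
  shows "norm (B (y q - y p)) \<le> K q - K p"
proof -
  have B: "((\<lambda>r. B (y r)) has_vector_derivative B (T 0 r (F r))) (at r)" for r
    using y unfolding mild_def
    by (intro bounded_linear.has_vector_derivative[OF blinfun.bounded_linear_right]) simp
  have "norm (B (y q) - B (y p)) \<le> K q - K p"
  proof (rule norm_increment_le[OF pq, of "{0}"])
    show "continuous_on {p..q} (\<lambda>r. B (y r))"
      using has_vector_derivative_continuous[OF B] by (intro continuous_at_imp_continuous_on) auto
    show "continuous_on {p..q} K" using K(1) continuous_on_subset by blast
  qed (use B K(2) bound in auto)
  then show ?thesis by (simp add: blinfun.diff_right)
qed

text \<open>The step common to the three components of the evolution; \<open>n\<close> stands for \<open>\<alpha> t r\<close>, \<open>\<beta>p t r\<close> or \<open>\<beta>m t r\<close>.\<close>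

lemma kernel_estimate:
  fixes Q :: "'a \<Rightarrow>\<^sub>L 'a"
  assumes F: "dominated s M F" and r: "r \<noteq> 0" and n: "norm (T t r o\<^sub>L Q) \<le> n"
    and kernel: "n * \<alpha> r s \<le> D * exp (\<epsilon> * \<bar>\<rho> r\<bar>) * \<alpha> t s"
  shows "norm (T t r (Q (F r))) \<le> M * \<alpha> t s * (\<delta> * bump \<gamma> r)"
proof -
  have M: "0 \<le> M" and F': "norm (F r) \<le> lip_bound r * (M * \<alpha> r s)"
    using F r by (auto simp: dominated_def)
  have "norm (T t r (Q (F r))) \<le> norm (T t r o\<^sub>L Q) * norm (F r)"
    using norm_blinfun[of "T t r o\<^sub>L Q" "F r"] by simp
  also have "\<dots> \<le> n * (lip_bound r * (M * \<alpha> r s))"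
    using n F' order_trans[OF norm_ge_zero n] by (intro mult_mono) auto
  also have "\<dots> = M * lip_bound r * (n * \<alpha> r s)" by (simp add: mult_ac)
  also have "\<dots> \<le> M * lip_bound r * (D * exp (\<epsilon> * \<bar>\<rho> r\<bar>) * \<alpha> t s)"
    using M lip_bound_nonneg by (intro mult_left_mono kernel) auto
  also have "\<dots> = M * \<alpha> t s * (D * exp (\<epsilon> * \<bar>\<rho> r\<bar>) * lip_bound r)" by (simp add: mult_ac)
  also have "\<dots> \<le> M * \<alpha> t s * (\<delta> * bump \<gamma> r)"
    using M alpha_pos[of t s] by (intro mult_left_mono lip_bound_bump) auto
  finally show ?thesis .
qed

lemma scaled_bump_primitive:
  "continuous_on UNIV (\<lambda>r. k * (\<delta> * bump_primitive \<gamma> r))"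
  "r \<noteq> 0 \<Longrightarrow> ((\<lambda>r. k * (\<delta> * bump_primitive \<gamma> r)) has_real_derivative k * (\<delta> * bump \<gamma> r)) (at r)"
  by (intro continuous_intros bump_primitive_cont)
    (intro DERIV_cmult bump_primitive_deriv)

lemma center_increment:
  assumes y: "mild F y" and F: "dominated s M F"
  shows "norm ((T t 0 o\<^sub>L P 0) (y t - y s))
    \<le> M * \<alpha> t s * (\<delta> * \<bar>bump_primitive \<gamma> t - bump_primitive \<gamma> s\<bar>)"
proof -
  have bound: "norm ((T t 0 o\<^sub>L P 0) (T 0 r (F r))) \<le> M * \<alpha> t s * (\<delta> * bump \<gamma> r)"
    if "r \<in> closed_segment s t" "r \<noteq> 0" for r
    using kernel_estimate[OF F that(2) T_P_norm alpha_between[OF that(1)]]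
    by (simp add: P_T T_cocycle)
  have nonneg: "0 \<le> M * \<alpha> t s * \<delta>"
    using F delta alpha_pos[of t s] by (simp add: dominated_def)
  show ?thesis
  proof (cases "s \<le> t")
    case True
    have "norm ((T t 0 o\<^sub>L P 0) (y t - y s))
      \<le> M * \<alpha> t s * (\<delta> * bump_primitive \<gamma> t) - M * \<alpha> t s * (\<delta> * bump_primitive \<gamma> s)"
      by (rule component_increment[OF y True scaled_bump_primitive bound])
        (use True in \<open>auto simp: closed_segment_eq_real_ivl\<close>)
    also have "\<dots> = M * \<alpha> t s * \<delta> * (bump_primitive \<gamma> t - bump_primitive \<gamma> s)"
      by (simp add: algebra_simps)
    also have "\<dots> \<le> M * \<alpha> t s * \<delta> * \<bar>bump_primitive \<gamma> t - bump_primitive \<gamma> s\<bar>"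
      by (intro mult_left_mono nonneg) simp
    finally show ?thesis by (simp add: mult.assoc)
  next
    case False
    then have ts: "t \<le> s" by simp
    have "norm ((T t 0 o\<^sub>L P 0) (y s - y t))
      \<le> M * \<alpha> t s * (\<delta> * bump_primitive \<gamma> s) - M * \<alpha> t s * (\<delta> * bump_primitive \<gamma> t)"
      by (rule component_increment[OF y ts scaled_bump_primitive bound])
        (use False in \<open>auto simp: closed_segment_eq_real_ivl\<close>)
    also have "\<dots> = M * \<alpha> t s * \<delta> * (bump_primitive \<gamma> s - bump_primitive \<gamma> t)"
      by (simp add: algebra_simps)
    also have "\<dots> \<le> M * \<alpha> t s * \<delta> * \<bar>bump_primitive \<gamma> t - bump_primitive \<gamma> s\<bar>"
      by (intro mult_left_mono nonneg) simp
    finally show ?thesis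
      by (simp add: mult.assoc blinfun.diff_right norm_minus_commute)
  qed
qed

lemma stable_increment:
  assumes y: "mild F y" and F: "dominated s M F" and pqt: "p \<le> q" "q \<le> t"
  shows "norm ((T t 0 o\<^sub>L Qp 0) (y q - y p))
    \<le> M * \<alpha> t s * (\<delta> * bump_primitive \<gamma> q) - M * \<alpha> t s * (\<delta> * bump_primitive \<gamma> p)"
proof (rule component_increment[OF y pqt(1) scaled_bump_primitive])
  fix r assume r: "p \<le> r" "r \<le> q" "r \<noteq> 0"
  with pqt have "r \<le> t" by simp
  then show "norm ((T t 0 o\<^sub>L Qp 0) (T 0 r (F r))) \<le> M * \<alpha> t s * (\<delta> * bump \<gamma> r)"
    using kernel_estimate[OF F r(3) T_Qp_norm beta_plus_alpha[OF d_le_a]]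
    by (simp add: Qp_T T_cocycle)
qed

lemma unstable_increment:
  assumes y: "mild F y" and F: "dominated s M F" and pqt: "p \<le> q" "t \<le> p"
  shows "norm ((T t 0 o\<^sub>L Qm 0) (y q - y p))
    \<le> M * \<alpha> t s * (\<delta> * bump_primitive \<gamma> q) - M * \<alpha> t s * (\<delta> * bump_primitive \<gamma> p)"
proof (rule component_increment[OF y pqt(1) scaled_bump_primitive])
  fix r assume r: "p \<le> r" "r \<le> q" "r \<noteq> 0"
  with pqt have "t \<le> r" by simp
  then show "norm ((T t 0 o\<^sub>L Qm 0) (T 0 r (F r))) \<le> M * \<alpha> t s * (\<delta> * bump \<gamma> r)"
    using kernel_estimate[OF F r(3) T_Qm_norm beta_minus_alpha[OF b_le_c]]
    by (simp add: Qm_T T_cocycle)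
qed

lemma stable_component_bound:
  assumes y: "mild F y" "tame y" and F: "dominated s M F"
  shows "norm (T t 0 (Qp 0 (y t))) \<le> M * \<alpha> t s * (\<delta> * (bump_primitive \<gamma> t + 1 / 2))"
proof (rule norm_le_of_tendsto_zero)
  show "((\<lambda>r. Qp 0 (y r)) \<longlongrightarrow> 0) at_bot" using y(2) by (simp add: tame_def)
  have nonneg: "0 \<le> M * \<alpha> t s * \<delta>"
    using F delta alpha_pos[of t s] by (simp add: dominated_def)
  show "\<forall>\<^sub>F p in at_bot. norm (T t 0 (Qp 0 (y t) - Qp 0 (y p)))
      \<le> M * \<alpha> t s * (\<delta> * (bump_primitive \<gamma> t + 1 / 2))"
    using eventually_le_at_bot[of t]
  proof eventually_elim
    case (elim p)
    have "- bump_primitive \<gamma> p \<le> 1 / 2"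
      using bump_primitive_bounds[of \<gamma> p] gamma by simp
    then have "M * \<alpha> t s * \<delta> * (bump_primitive \<gamma> t - bump_primitive \<gamma> p)
        \<le> M * \<alpha> t s * \<delta> * (bump_primitive \<gamma> t + 1 / 2)"
      by (intro mult_left_mono nonneg) simp
    with stable_increment[OF y(1) F elim order_refl] show ?case
      by (simp add: blinfun.diff_right algebra_simps)
  qed
qed simp

lemma unstable_component_bound:
  assumes y: "mild F y" "tame y" and F: "dominated s M F"
  shows "norm (T t 0 (Qm 0 (y t))) \<le> M * \<alpha> t s * (\<delta> * (1 / 2 - bump_primitive \<gamma> t))"
proof (rule norm_le_of_tendsto_zero)
  show "((\<lambda>r. Qm 0 (y r)) \<longlongrightarrow> 0) at_top" using y(2) by (simp add: tame_def)
  have nonneg: "0 \<le> M * \<alpha> t s * \<delta>"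
    using F delta alpha_pos[of t s] by (simp add: dominated_def)
  show "\<forall>\<^sub>F p in at_top. norm (T t 0 (Qm 0 (y t) - Qm 0 (y p)))
      \<le> M * \<alpha> t s * (\<delta> * (1 / 2 - bump_primitive \<gamma> t))"
    using eventually_ge_at_top[of t]
  proof eventually_elim
    case (elim p)
    have "bump_primitive \<gamma> p \<le> 1 / 2"
      using bump_primitive_bounds[of \<gamma> p] gamma by simp
    then have "M * \<alpha> t s * \<delta> * (bump_primitive \<gamma> p - bump_primitive \<gamma> t)
        \<le> M * \<alpha> t s * \<delta> * (1 / 2 - bump_primitive \<gamma> t)"
      by (intro mult_left_mono nonneg) simp
    with unstable_increment[OF y(1) F elim order_refl] show ?case
      by (simp add: blinfun.diff_right norm_minus_commute algebra_simps)
  qed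
qed simp

text \<open>The center component is estimated from \<open>s\<close> to \<open>t\<close>, the stable one from \<open>-\<infinity>\<close> to \<open>t\<close> and the unstable
  one from \<open>t\<close> to \<open>+\<infinity>\<close>. The last two increments of \<open>bump_primitive\<close> add up to 1, and the first is at
  most 1; this is the factor 2.\<close>

theorem tame_estimate:
  assumes y: "mild F y" "tame y" and F: "dominated s M F"
  shows "norm (T t 0 (y t)) \<le> (norm (P s (T s 0 (y s))) + 2 * \<delta> * M) * \<alpha> t s"
proof -
  have nonneg: "0 \<le> M * \<alpha> t s * \<delta>"
    using F delta alpha_pos[of t s] by (simp add: dominated_def)
  have split: "norm (w + x + y + z) \<le> norm w + norm x + norm y + norm z" for w x y z :: 'a
    using norm_triangle_ineq[of "w + x + y" z] norm_triangle_ineq[of "w + x" y]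
      norm_triangle_ineq[of w x] by linarith
  have "y t = P 0 (y s) + P 0 (y t - y s) + Qp 0 (y t) + Qm 0 (y t)"
    by (simp add: decomposition blinfun.diff_right)
  from arg_cong[OF this, of "T t 0"]
  have "T t 0 (y t) = T t 0 (P 0 (y s)) + T t 0 (P 0 (y t - y s)) + T t 0 (Qp 0 (y t))
      + T t 0 (Qm 0 (y t))"
    by (simp only: blinfun.add_right)
  then have "norm (T t 0 (y t)) \<le> norm (T t 0 (P 0 (y s))) + norm (T t 0 (P 0 (y t - y s)))
      + norm (T t 0 (Qp 0 (y t))) + norm (T t 0 (Qm 0 (y t)))"
    by (simp only: split)
  also have "T t 0 (P 0 (y s)) = (T t s o\<^sub>L P s) (P s (T s 0 (y s)))"
    by (simp add: P_T T_cocycle)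
  also have "norm \<dots> \<le> \<alpha> t s * norm (P s (T s 0 (y s)))"
    by (rule order_trans[OF norm_blinfun mult_right_mono[OF T_P_norm norm_ge_zero]])
  also have "norm (T t 0 (P 0 (y t - y s)))
      \<le> M * \<alpha> t s * \<delta> * \<bar>bump_primitive \<gamma> t - bump_primitive \<gamma> s\<bar>"
    using center_increment[OF y(1) F, of t] by (simp add: mult.assoc)
  also have "\<dots> \<le> M * \<alpha> t s * \<delta> * 1"
    using bump_primitive_bounds[of \<gamma> t] bump_primitive_bounds[of \<gamma> s] gamma
    by (intro mult_left_mono nonneg) simp
  also note stable_component_bound[OF y F, of t]
  also note unstable_component_bound[OF y F, of t]
  finally show ?thesis by (simp add: algebra_simps)
qed

text \<open>At the base time the weight \<open>\<alpha> s s\<close> of the previous estimate, which for \<open>\<epsilon> > 0\<close> is unbounded in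
  \<open>s\<close>, would spoil the Lipschitz constant of the graph. The kernels \<open>stable_kernel\<close> and \<open>unstable_kernel\<close> avoid it.\<close>

theorem tame_hyperbolic_estimate:
  assumes y: "mild F y" "tame y" and F: "dominated s M F"
  shows "norm (T s 0 (y s) - P s (T s 0 (y s))) \<le> 2 * \<delta> * M"
proof -
  have M: "0 \<le> M" using F by (simp add: dominated_def)
  have weight: "norm (T s r (Q (F r))) \<le> M * k"
    if "r \<noteq> 0" "norm (T s r o\<^sub>L Q) \<le> n" "n * lip_bound r * \<alpha> r s \<le> k"
    for r n k and Q :: "'a \<Rightarrow>\<^sub>L 'a"
  proof -
    have "norm (T s r (Q (F r))) \<le> norm (T s r o\<^sub>L Q) * norm (F r)"
      using norm_blinfun[of "T s r o\<^sub>L Q" "F r"] by simp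
    also have "\<dots> \<le> n * (lip_bound r * (M * \<alpha> r s))"
      using that F order_trans[OF norm_ge_zero that(2)]
      by (intro mult_mono) (auto simp: dominated_def)
    also have "\<dots> = M * (n * lip_bound r * \<alpha> r s)" by (simp add: mult_ac)
    also have "\<dots> \<le> M * k" by (intro mult_left_mono that M)
    finally show ?thesis .
  qed
  have "norm (T s 0 (Qp 0 (y s))) \<le> M * \<delta>"
  proof (rule norm_le_of_tendsto_zero)
    show "((\<lambda>r. Qp 0 (y r)) \<longlongrightarrow> 0) at_bot" using y(2) by (simp add: tame_def)
    show "\<forall>\<^sub>F p in at_bot. norm (T s 0 (Qp 0 (y s) - Qp 0 (y p))) \<le> M * \<delta>"
      using eventually_le_at_bot[of s]
    proof eventually_elim
      case (elim p)
      have "norm ((T s 0 o\<^sub>L Qp 0) (y s - y p))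
          \<le> M * (\<delta> * stable_kernel s s) - M * (\<delta> * stable_kernel s p)"
      proof (rule component_increment[OF y(1) elim])
        show "continuous_on UNIV (\<lambda>r. M * (\<delta> * stable_kernel s r))"
          by (intro continuous_intros kernel_cont)
        show "((\<lambda>r. M * (\<delta> * stable_kernel s r)) has_real_derivative
            M * (\<delta> * ((- c - d - \<epsilon> * sgn r) * \<rho>' r * stable_kernel s r))) (at r)" if "r \<noteq> 0" for r
          using that by (intro DERIV_cmult stable_kernel_deriv)
        show "norm ((T s 0 o\<^sub>L Qp 0) (T 0 r (F r)))
            \<le> M * (\<delta> * ((- c - d - \<epsilon> * sgn r) * \<rho>' r * stable_kernel s r))"
          if "r \<le> s" "r \<noteq> 0" for r
          using weight[OF that(2) T_Qp_norm stable_kernel_bound] that(1)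
          by (simp add: Qp_T T_cocycle)
      qed
      also have "\<dots> \<le> M * \<delta>"
        using M delta by (simp add: stable_kernel_def)
      finally show ?case by (simp add: blinfun.diff_right)
    qed
  qed simp
  moreover have "norm (T s 0 (Qm 0 (y s))) \<le> M * \<delta>"
  proof (rule norm_le_of_tendsto_zero)
    show "((\<lambda>r. Qm 0 (y r)) \<longlongrightarrow> 0) at_top" using y(2) by (simp add: tame_def)
    show "\<forall>\<^sub>F p in at_top. norm (T s 0 (Qm 0 (y s) - Qm 0 (y p))) \<le> M * \<delta>"
      using eventually_ge_at_top[of s]
    proof eventually_elim
      case (elim p)
      have "norm ((T s 0 o\<^sub>L Qm 0) (y p - y s))
          \<le> M * (\<delta> * - unstable_kernel s p) - M * (\<delta> * - unstable_kernel s s)"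
      proof (rule component_increment[OF y(1) elim])
        show "continuous_on UNIV (\<lambda>r. M * (\<delta> * - unstable_kernel s r))"
          by (intro continuous_intros kernel_cont)
        show "((\<lambda>r. M * (\<delta> * - unstable_kernel s r)) has_real_derivative
            M * (\<delta> * ((- a - b + \<epsilon> * sgn r) * \<rho>' r * unstable_kernel s r))) (at r)" if "r \<noteq> 0" for r
          using that by (intro DERIV_cmult unstable_kernel_deriv)
        show "norm ((T s 0 o\<^sub>L Qm 0) (T 0 r (F r)))
            \<le> M * (\<delta> * ((- a - b + \<epsilon> * sgn r) * \<rho>' r * unstable_kernel s r))"
          if "s \<le> r" "r \<noteq> 0" for r
          using weight[OF that(2) T_Qm_norm unstable_kernel_bound] that(1)
          by (simp add: Qm_T T_cocycle)
      qed
      also have "\<dots> \<le> M * \<delta>"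
        using M delta by (simp add: unstable_kernel_def)
      finally show ?case by (simp add: blinfun.diff_right norm_minus_commute)
    qed
  qed simp
  moreover have "T s 0 (y s) - P s (T s 0 (y s)) = T s 0 (Qp 0 (y s)) + T s 0 (Qm 0 (y s))"
    using decomposition[of s "T s 0 (y s)"] by (simp add: P_T Qp_T Qm_T algebra_simps)
  ultimately have "norm (T s 0 (y s) - P s (T s 0 (y s))) \<le> M * \<delta> + M * \<delta>"
    using norm_triangle_ineq[of "T s 0 (Qp 0 (y s))" "T s 0 (Qm 0 (y s))"] by simp
  then show ?thesis by (simp add: algebra_simps)
qed

text \<open>Any antiderivative \<open>Y\<close> of \<open>T 0 r (F r)\<close> has the limits \<open>lp\<close> and \<open>lm\<close> in its stable and unstable
  components; subtracting them, and adjusting the center component, makes it tame.\<close>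

theorem tame_solution_exists:
  assumes F: "continuous_on UNIV F" "dominated s M F"
  shows "\<exists>y. mild F y \<and> tame y \<and> P s (T s 0 (y s)) = P s x"
proof -
  have "continuous_on UNIV (\<lambda>r. T 0 r (F r))"
    by (intro bounded_bilinear.continuous_on[OF bounded_bilinear_blinfun_apply] T_cont F)
  then obtain Y where Y: "mild F Y"
    unfolding mild_def using antiderivative_on_UNIV by blast
  have K: "\<bar>M * \<alpha> 0 s * (\<delta> * bump_primitive \<gamma> p)\<bar> \<le> M * \<alpha> 0 s * \<delta> * (1 / 2)" for p
  proof -
    have k: "0 \<le> M * \<alpha> 0 s * \<delta>"
      using F delta alpha_pos[of 0 s] by (simp add: dominated_def)
    have "\<bar>M * \<alpha> 0 s * (\<delta> * bump_primitive \<gamma> p)\<bar> = M * \<alpha> 0 s * \<delta> * \<bar>bump_primitive \<gamma> p\<bar>"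
      using abs_mult[of "M * \<alpha> 0 s * \<delta>" "bump_primitive \<gamma> p"] abs_of_nonneg[OF k]
      by (simp add: mult.assoc)
    also have "\<dots> \<le> M * \<alpha> 0 s * \<delta> * (1 / 2)"
      by (intro mult_left_mono k bump_primitive_bounds) (use gamma in simp)
    finally show ?thesis .
  qed
  have "\<exists>l. ((\<lambda>r. Qp 0 (Y r)) \<longlongrightarrow> l) at_bot"
  proof (rule convergent_at_bot_of_dominated_increments)
    show "norm (Qp 0 (Y q) - Qp 0 (Y p))
        \<le> M * \<alpha> 0 s * (\<delta> * bump_primitive \<gamma> q) - M * \<alpha> 0 s * (\<delta> * bump_primitive \<gamma> p)"
      if "p \<le> q" "q \<le> 0" for p q
      using stable_increment[OF Y F(2) that] by (simp add: blinfun.diff_right)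
    show "- (M * \<alpha> 0 s * \<delta> * (1 / 2)) \<le> M * \<alpha> 0 s * (\<delta> * bump_primitive \<gamma> p)" for p
      using K[of p] by (simp only: abs_le_iff minus_le_iff)
  qed
  then obtain lp where lp: "((\<lambda>r. Qp 0 (Y r)) \<longlongrightarrow> lp) at_bot" by blast
  have "\<exists>l. ((\<lambda>r. Qm 0 (Y r)) \<longlongrightarrow> l) at_top"
  proof (rule convergent_at_top_of_dominated_increments)
    show "norm (Qm 0 (Y q) - Qm 0 (Y p))
        \<le> M * \<alpha> 0 s * (\<delta> * bump_primitive \<gamma> q) - M * \<alpha> 0 s * (\<delta> * bump_primitive \<gamma> p)"
      if "p \<le> q" "0 \<le> p" for p q
      using unstable_increment[OF Y F(2) that] by (simp add: blinfun.diff_right)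
    show "M * \<alpha> 0 s * (\<delta> * bump_primitive \<gamma> p) \<le> M * \<alpha> 0 s * \<delta> * (1 / 2)" for p
      using K[of p] by (simp only: abs_le_iff)
  qed
  then obtain lm where lm: "((\<lambda>r. Qm 0 (Y r)) \<longlongrightarrow> lm) at_top" by blast
  have lp': "Qp 0 lp = lp"
    using tendsto_unique[OF _ _ lp, of "Qp 0 lp"] blinfun.tendsto[OF tendsto_const lp, of "Qp 0"]
    by simp
  have lm': "Qm 0 lm = lm"
    using tendsto_unique[OF _ _ lm, of "Qm 0 lm"] blinfun.tendsto[OF tendsto_const lm, of "Qm 0"]
    by simp
  define k where "k = P 0 (T 0 s x - Y s) - Qp 0 lp - Qm 0 lm"
  have "Qp 0 lm = 0" "Qm 0 lp = 0"
    using Qp_Qm[of 0 lm] Qm_Qp[of 0 lp] lp' lm' by simp_all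
  then have k: "Qp 0 k = - lp" "Qm 0 k = - lm"
    by (simp_all add: k_def blinfun.diff_right lp' lm')
  have "mild F (\<lambda>r. Y r + k)"
    using Y by (auto simp: mild_def intro!: derivative_eq_intros)
  moreover have "tame (\<lambda>r. Y r + k)"
    using tendsto_diff[OF lp tendsto_const[of lp]] tendsto_diff[OF lm tendsto_const[of lm]]
    by (simp add: tame_def k blinfun.add_right)
  moreover have "P s (T s 0 (Y s + k)) = P s x"
    by (simp add: P_T k_def blinfun.add_right blinfun.diff_right T_cocycle)
  ultimately show ?thesis by blast
qed

section \<open>Center solutions\<close>

lemma perturbation_dominated:
  assumes "0 \<le> M" "\<And>t. norm (v t - w t) \<le> M * \<alpha> t s"
  shows "dominated s M (\<lambda>r. f r (v r) - f r (w r))"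
  unfolding dominated_def
proof (intro conjI allI impI)
  fix r :: real assume "r \<noteq> 0"
  then have "norm (f r (v r) - f r (w r)) \<le> lip_bound r * norm (v r - w r)"
    by (rule f_lip)
  also have "\<dots> \<le> lip_bound r * (M * \<alpha> r s)"
    by (intro mult_left_mono assms lip_bound_nonneg)
  finally show "norm (f r (v r) - f r (w r)) \<le> lip_bound r * (M * \<alpha> r s)" .
qed (rule assms)

definition center_solution :: "(real \<Rightarrow> 'a) \<Rightarrow> bool" where
  "center_solution v \<longleftrightarrow> ode_solution rhs v \<and> (\<exists>K. \<forall>t. norm (v t) \<le> K * \<alpha> t 0)"

lemma center_growth_rebase:
  assumes "\<And>t. norm (v t) \<le> K * \<alpha> t s" shows "\<exists>K'. \<forall>t. norm (v t) \<le> K' * \<alpha> t s'"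
proof -
  have K: "0 \<le> K"
    using order_trans[OF norm_ge_zero assms[of 0]] alpha_pos[of 0 s] by (simp add: zero_le_mult_iff)
  obtain C where "\<And>t. \<alpha> t s \<le> C * \<alpha> t s'" using alpha_comparable by blast
  then have "norm (v t) \<le> K * (C * \<alpha> t s')" for t
    using order_trans[OF assms mult_left_mono[OF _ K]] by blast
  then show ?thesis by (intro exI[of _ "K * C"]) (simp add: mult.assoc)
qed

lemma center_solution_difference_mild:
  assumes "center_solution v" "center_solution w"
  shows "mild (\<lambda>r. f r (v r) - f r (w r)) (\<lambda>t. T 0 t (v t - w t))"
    and "tame (\<lambda>t. T 0 t (v t - w t))"
proof -
  have "((\<lambda>r. v r - w r) has_vector_derivative A t (v t - w t) + (f t (v t) - f t (w t))) (at t)" for t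
  proof -
    have "((\<lambda>r. v r - w r) has_vector_derivative rhs t (v t) - rhs t (w t)) (at t)"
      using assms by (auto simp: center_solution_def ode_solution_def intro!: derivative_intros)
    then show ?thesis by (simp add: blinfun.diff_right algebra_simps)
  qed
  then show "mild (\<lambda>r. f r (v r) - f r (w r)) (\<lambda>t. T 0 t (v t - w t))"
    unfolding mild_def by (intro allI variation_of_constants)
  obtain K K' where K: "\<And>t. norm (v t) \<le> K * \<alpha> t 0" "\<And>t. norm (w t) \<le> K' * \<alpha> t 0"
    using assms by (auto simp: center_solution_def)
  have "norm (T t 0 (T 0 t (v t - w t))) \<le> (K + K') * \<alpha> t 0" for t
    using norm_triangle_ineq4[of "v t" "w t"] K[of t] by (simp add: distrib_right)
  then show "tame (\<lambda>t. T 0 t (v t - w t))" by (rule tame_of_growth)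
qed

text \<open>The difference of two center solutions solves an inhomogeneous equation whose right-hand side is
  controlled by the difference itself, so \<open>tame_estimate\<close> improves any bound for it.\<close>

theorem center_solution_difference:
  assumes v: "center_solution v" and w: "center_solution w"
  shows "norm (v t - w t) \<le> norm (P s (v s - w s)) / (1 - 2 * \<delta>) * \<alpha> t s"
proof -
  obtain K K' where K: "\<And>t. norm (v t) \<le> K * \<alpha> t s" "\<And>t. norm (w t) \<le> K' * \<alpha> t s"
    using v w center_growth_rebase unfolding center_solution_def by metis
  show ?thesis
  proof (rule self_improving_bound[where I = UNIV and h = "\<lambda>t. norm (v t - w t)" and W = "\<lambda>t. \<alpha> t s"])
    show "norm (v t - w t) \<le> (K + K') * \<alpha> t s" for t
      using norm_triangle_ineq4[of "v t" "w t"] K[of t] by (simp add: distrib_right)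
    show "norm (v t - w t) \<le> (norm (P s (v s - w s)) + 2 * \<delta> * M) * \<alpha> t s"
      if "0 \<le> M" and "\<And>t. t \<in> UNIV \<Longrightarrow> norm (v t - w t) \<le> M * \<alpha> t s" for M t
      using tame_estimate[OF center_solution_difference_mild[OF v w] perturbation_dominated, of M s t] that
      by simp
  qed (use delta alpha_pos in auto)
qed

theorem center_solution_hyperbolic_difference:
  assumes v: "center_solution v" and w: "center_solution w"
  shows "norm ((v s - w s) - P s (v s - w s)) \<le> 2 * \<delta> / (1 - 2 * \<delta>) * norm (P s (v s - w s))"
proof -
  have "norm (T s 0 (T 0 s (v s - w s)) - P s (T s 0 (T 0 s (v s - w s))))
      \<le> 2 * \<delta> * (norm (P s (v s - w s)) / (1 - 2 * \<delta>))"
    using delta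
    by (intro tame_hyperbolic_estimate[OF center_solution_difference_mild[OF v w]]
        perturbation_dominated center_solution_difference v w) auto
  then show ?thesis by simp
qed

text \<open>The fixed point argument takes place in the space weighted by \<open>\<alpha> t s\<close>; \<open>R v u\<close> says that \<open>u\<close> is
  the slowly growing solution of \<open>u' = A u + f v\<close> with the prescribed center component at \<open>s\<close>.\<close>

theorem center_solution_exists: "\<exists>v. center_solution v \<and> P s (v s) = P s x"
proof -
  define R where "R v u \<longleftrightarrow> (\<exists>y. mild (\<lambda>t. f t (v t)) y \<and> tame y \<and>
      P s (T s 0 (y s)) = P s x \<and> u = (\<lambda>t. T t 0 (y t)))" for v u
  have y_cont: "continuous_on UNIV (\<lambda>t. T t 0 (y t))" if "mild F y" for F y
  proof -
    have "continuous_on UNIV y"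
      using that has_vector_derivative_continuous unfolding mild_def
      by (intro continuous_at_imp_continuous_on) blast
    then show ?thesis
      by (intro bounded_bilinear.continuous_on[OF bounded_bilinear_blinfun_apply] T_cont)
  qed
  have "\<exists>v M. R v v \<and> continuous_on UNIV v \<and> (\<forall>t. norm (v t) \<le> M * \<alpha> t s)"
  proof (rule weighted_fixed_point[where q = "2 * \<delta>" and R = R and W = "\<lambda>t. \<alpha> t s"])
    fix v :: "real \<Rightarrow> 'a" and M assume v: "continuous_on UNIV v" and b: "\<And>t. norm (v t) \<le> M * \<alpha> t s"
    have "0 \<le> M"
      using order_trans[OF norm_ge_zero b[of 0]] alpha_pos[of 0 s] by (simp add: zero_le_mult_iff)
    then have F: "dominated s M (\<lambda>t. f t (v t))"
      using perturbation_dominated[of M v "\<lambda>_. 0" s] b by (simp add: f_zero)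
    have "continuous_on UNIV (\<lambda>t. f t (v t))" by (rule continuous_along_path[OF f_cont v])
    then obtain y where y: "mild (\<lambda>t. f t (v t)) y" "tame y" "P s (T s 0 (y s)) = P s x"
      using tame_solution_exists[OF _ F] by blast
    show "\<exists>u M'. R v u \<and> continuous_on UNIV u \<and> (\<forall>t. norm (u t) \<le> M' * \<alpha> t s)"
    proof (intro exI conjI allI)
      show "R v (\<lambda>t. T t 0 (y t))" using y by (auto simp: R_def)
      show "norm (T t 0 (y t)) \<le> (norm (P s x) + 2 * \<delta> * M) * \<alpha> t s" for t
        using tame_estimate[OF y(1,2) F] y(3) by simp
    qed (rule y_cont[OF y(1)])
  next
    fix v v' u u' :: "real \<Rightarrow> 'a" and M t
    assume R: "R v u" "R v' u'" and M: "0 \<le> M" and b: "\<And>t. norm (v t - v' t) \<le> M * \<alpha> t s"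
    obtain y where y: "mild (\<lambda>t. f t (v t)) y" "tame y" "P s (T s 0 (y s)) = P s x"
      "u = (\<lambda>t. T t 0 (y t))"
      using R(1) by (auto simp: R_def)
    obtain z where z: "mild (\<lambda>t. f t (v' t)) z" "tame z" "P s (T s 0 (z s)) = P s x"
      "u' = (\<lambda>t. T t 0 (z t))"
      using R(2) by (auto simp: R_def)
    have "mild (\<lambda>t. f t (v t) - f t (v' t)) (\<lambda>t. y t - z t)"
      using y(1) z(1) by (auto simp: mild_def blinfun.diff_right intro!: derivative_intros)
    from tame_estimate[OF this tame_diff[OF y(2) z(2)] perturbation_dominated[OF M b], of t]
    show "norm (u t - u' t) \<le> 2 * \<delta> * M * \<alpha> t s"
      using y(3,4) z(3,4) by (simp add: blinfun.diff_right)
  qed (use delta alpha_cont alpha_pos in auto)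
  then obtain v M where v: "R v v" "\<And>t. norm (v t) \<le> M * \<alpha> t s" by blast
  then obtain y where y: "mild (\<lambda>t. f t (v t)) y" "P s (T s 0 (y s)) = P s x"
    and vy: "v = (\<lambda>t. T t 0 (y t))"
    by (auto simp: R_def)
  have "((\<lambda>t. T t 0 (y t)) has_vector_derivative A t (T t 0 (y t)) + f t (v t)) (at t)" for t
    using y(1) by (intro variation_of_constants_converse) (simp add: mild_def)
  then have "ode_solution rhs v"
    unfolding ode_solution_def vy by simp
  moreover have "\<exists>K. \<forall>t. norm (v t) \<le> K * \<alpha> t 0"
    by (rule center_growth_rebase[OF v(2)])
  moreover have "P s (v s) = P s x" using y(2) vy by metis
  ultimately show ?thesis
    unfolding center_solution_def by blast
qed

definition center_through :: "real \<Rightarrow> 'a \<Rightarrow> real \<Rightarrow> 'a" where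
  "center_through s x = (SOME v. center_solution v \<and> P s (v s) = P s x)"

lemma center_through: "center_solution (center_through s x)" "P s (center_through s x s) = P s x"
  using someI_ex[OF center_solution_exists[of s x]] by (simp_all add: center_through_def)

lemma center_solution_determined:
  assumes "center_solution v" "center_solution w" "P s (v s) = P s (w s)"
  shows "v = w"
proof
  fix t
  show "v t = w t"
    using center_solution_difference[OF assms(1,2), of t s] assms(3) by (simp add: blinfun.diff_right)
qed

lemma center_through_eq:
  assumes "center_solution v" shows "center_through s (P s (v s)) = v"
  using center_through[of s "P s (v s)"] assms center_solution_determined by simp

end

section \<open>The invariant graph\<close>

context perturbed_trichotomy
begin

lemma center_bundle_iff: "(s, \<xi>) \<in> center_bundle P \<longleftrightarrow> P s \<xi> = \<xi>"
proof -
  have "(\<exists>x. \<xi> = P s x) \<longleftrightarrow> P s \<xi> = \<xi>"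
    using P_P[of s] by metis
  then show ?thesis by (simp add: center_bundle_def image_iff)
qed

lemma range_P_iff: "\<xi> \<in> range (P s) \<longleftrightarrow> P s \<xi> = \<xi>"
  using center_bundle_iff[of s \<xi>] by (simp add: center_bundle_def)

lemma flow_map_zero: "flow_map A f \<tau> (s, 0) = (s + \<tau>, 0)"
  using flow_map_eq[OF zero_solution] .

text \<open>The constant \<open>k\<close> in the growth bound is left free: existence asks for a large one, while uniqueness
  holds for every \<open>k\<close>.\<close>

definition center_manifold :: "real \<Rightarrow> real \<Rightarrow> (real \<times> 'a \<Rightarrow> 'a) \<Rightarrow> bool" where
  "center_manifold N k \<phi> \<longleftrightarrow> \<phi> \<in> A_N P Qp Qm N \<and>
    (\<forall>\<tau>. flow_map A f \<tau> ` manifold P \<phi> \<subseteq> manifold P \<phi>) \<and>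
    (\<forall>t s. \<forall>\<xi> \<in> range (P s). \<forall>\<xi>' \<in> range (P s).
      norm (snd (flow_map A f (t - s) (graph_point \<phi> s \<xi>)) -
            snd (flow_map A f (t - s) (graph_point \<phi> s \<xi>')))
        \<le> k * \<alpha> t s * norm (\<xi> - \<xi>'))"

lemma A_N_extensional: "\<phi> \<in> A_N P Qp Qm N \<Longrightarrow> z \<notin> center_bundle P \<Longrightarrow> \<phi> z = undefined"
  by (cases z) (auto simp: A_N_def PiE_def extensional_def)

lemma A_N_zero: "\<phi> \<in> A_N P Qp Qm N \<Longrightarrow> \<phi> (t, 0) = 0"
  by (simp add: A_N_def)

lemma A_N_P_zero:
  assumes "\<phi> \<in> A_N P Qp Qm N" "(s, \<xi>) \<in> center_bundle P" shows "P s (\<phi> (s, \<xi>)) = 0"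
proof -
  have "\<exists>u\<in>range (Qp s). \<exists>w\<in>range (Qm s). \<phi> (s, \<xi>) = u + w"
    using assms by (auto simp: A_N_def)
  then show ?thesis by (auto simp: blinfun.add_right)
qed

text \<open>Without center directions the rates \<open>a\<close> and \<open>c\<close> carry no information about the equation, but then the
  bundle is the zero section and \<open>A_N\<close> has only one element.\<close>

lemma trivial_center_manifold:
  assumes "P 0 = 0" and N: "0 \<le> N"
  shows "\<exists>!\<phi>. center_manifold N k \<phi>"
proof -
  have P0: "P t x = 0" for t x
    using P_T[of t 0 "T 0 t x"] assms by simp
  have fibres: "center_bundle P = UNIV \<times> {0}"
    by (auto simp: center_bundle_iff P0)
  define \<phi>\<^sub>0 :: "real \<times> 'a \<Rightarrow> 'a" where "\<phi>\<^sub>0 = (\<lambda>z\<in>UNIV \<times> {0}. 0)"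
  have range: "range (P t) = {0}" for t by (auto simp: P0)
  show ?thesis
  proof
    have "continuous_on (UNIV \<times> {0}) \<phi>\<^sub>0"
      by (subst continuous_on_cong[OF refl, of _ _ "\<lambda>_. 0"]) (auto simp: \<phi>\<^sub>0_def)
    then have "\<phi>\<^sub>0 \<in> A_N P Qp Qm N"
      unfolding A_N_def mem_Collect_eq fibres range
      by (intro conjI) (auto simp: \<phi>\<^sub>0_def blinfun.zero_right intro!: exI[of _ 0])
    moreover have "manifold P \<phi>\<^sub>0 = UNIV \<times> {0}"
      by (auto simp: manifold_def graph_point_def fibres \<phi>\<^sub>0_def)
    moreover have "flow_map A f \<tau> ` (UNIV \<times> {0}) \<subseteq> UNIV \<times> {0}" for \<tau>
      by (auto simp: flow_map_zero)
    ultimately show "center_manifold N k \<phi>\<^sub>0"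
      by (simp add: center_manifold_def range)
  next
    fix \<phi> assume "center_manifold N k \<phi>"
    then have "\<phi> \<in> A_N P Qp Qm N" by (simp add: center_manifold_def)
    from A_N_extensional[OF this] A_N_zero[OF this] show "\<phi> = \<phi>\<^sub>0"
      by (auto simp: fun_eq_iff \<phi>\<^sub>0_def fibres restrict_def)
  qed
qed

end

context central_trichotomy
begin

text \<open>The hyperbolic component at time \<open>s\<close> of the center solution with center component \<open>\<xi>\<close>.\<close>

definition center_map :: "real \<times> 'a \<Rightarrow> 'a" where
  "center_map = (\<lambda>(s, \<xi>)\<in>center_bundle P. center_through s \<xi> s - \<xi>)"

lemma center_map_of_solution:
  assumes "center_solution v"
  shows "(s, P s (v s)) \<in> center_bundle P" "center_map (s, P s (v s)) = v s - P s (v s)"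
    "graph_point center_map s (P s (v s)) = (s, v s)"
  using center_through_eq[OF assms, of s] by (simp_all add: center_map_def center_bundle_iff graph_point_def)

lemma bundle_point_of_solution:
  assumes "(s, \<xi>) \<in> center_bundle P"
  obtains v where "center_solution v" "P s (v s) = \<xi>"
  using center_through[of s \<xi>] assms that by (auto simp: center_bundle_iff)

lemma manifold_center_map: "manifold P center_map = {(s, v s) | s v. center_solution v}"
proof (intro equalityI subsetI)
  fix z assume "z \<in> manifold P center_map"
  then obtain s \<xi> where z: "z = graph_point center_map s \<xi>" "(s, \<xi>) \<in> center_bundle P"
    by (auto simp: manifold_def)
  obtain v where "center_solution v" "P s (v s) = \<xi>" by (rule bundle_point_of_solution[OF z(2)])
  then show "z \<in> {(s, v s) | s v. center_solution v}"
    using z(1) center_map_of_solution(3)[of v s] by auto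
next
  fix z assume "z \<in> {(s, v s) | s v. center_solution v}"
  then obtain s v where z: "z = (s, v s)" "center_solution v" by auto
  from center_map_of_solution[OF z(2), of s] z(1) show "z \<in> manifold P center_map"
    unfolding manifold_def by (auto intro!: exI[of _ s] exI[of _ "P s (v s)"])
qed

lemma center_map_lipschitz:
  assumes "(s, \<xi>) \<in> center_bundle P" "(s, \<xi>') \<in> center_bundle P"
  shows "norm (center_map (s, \<xi>) - center_map (s, \<xi>')) \<le> 1 / 2 * norm (\<xi> - \<xi>')"
proof -
  obtain v where v: "center_solution v" "P s (v s) = \<xi>" by (rule bundle_point_of_solution[OF assms(1)])
  obtain w where w: "center_solution w" "P s (w s) = \<xi>'" by (rule bundle_point_of_solution[OF assms(2)])
  have "center_map (s, \<xi>) - center_map (s, \<xi>') = (v s - w s) - P s (v s - w s)"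
    using center_map_of_solution(2)[OF v(1), of s] center_map_of_solution(2)[OF w(1), of s] v(2) w(2)
    by (simp add: blinfun.diff_right)
  then have "norm (center_map (s, \<xi>) - center_map (s, \<xi>')) \<le> 2 * \<delta> / (1 - 2 * \<delta>) * norm (\<xi> - \<xi>')"
    using center_solution_hyperbolic_difference[OF v(1) w(1), of s] v(2) w(2)
    by (simp add: blinfun.diff_right)
  also have "2 * \<delta> / (1 - 2 * \<delta>) \<le> 1 / 2"
    using delta by (simp add: pos_divide_le_eq)
  finally show ?thesis by (simp add: mult_right_mono)
qed

text \<open>Continuity along the base comes from invariance: near \<open>(s, \<xi>)\<close>, compare \<open>center_map (s', \<xi>')\<close>
  with its value at the center component of \<open>v s'\<close>, where \<open>v\<close> is the center solution through
  \<open>(s, \<xi>)\<close>. That value is \<open>v s' - P s' (v s')\<close>, which is continuous in \<open>s'\<close>, and the error is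
  controlled by the Lipschitz property in the fibre over \<open>s'\<close>.\<close>

lemma center_map_cont: "continuous_on (center_bundle P) center_map"
  unfolding continuous_on_def
proof
  fix z assume z: "z \<in> center_bundle P"
  obtain s \<xi> where z_eq: "z = (s, \<xi>)" by fastforce
  obtain v where v: "center_solution v" "P s (v s) = \<xi>"
    by (rule bundle_point_of_solution[OF z[unfolded z_eq]])
  define h where "h z = P (fst z) (v (fst z))" for z :: "real \<times> 'a"
  have v_cont: "continuous_on UNIV v"
    using v(1) unfolding center_solution_def by (blast intro: ode_solution_continuous)
  have "continuous_on UNIV (\<lambda>t. P t (v t))"
    by (intro bounded_bilinear.continuous_on[OF bounded_bilinear_blinfun_apply] P_cont v_cont)
  then have "isCont (\<lambda>t. P t (v t)) s" "isCont v s"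
    using v_cont by (auto simp: continuous_on_eq_continuous_at)
  moreover have "(fst \<longlongrightarrow> s) (at z within center_bundle P)"
    using tendsto_fst[OF tendsto_ident_at, of z] z_eq by simp
  ultimately have lim: "(h \<longlongrightarrow> \<xi>) (at z within center_bundle P)"
    "((\<lambda>z. v (fst z)) \<longlongrightarrow> v s) (at z within center_bundle P)"
    using isCont_tendsto_compose[of s "\<lambda>t. P t (v t)"] isCont_tendsto_compose[of s v] v(2)
    unfolding h_def by blast+
  have snd_lim: "(snd \<longlongrightarrow> \<xi>) (at z within center_bundle P)"
    using tendsto_snd[OF tendsto_ident_at, of z] z_eq by simp
  have "((\<lambda>z. center_map z - (v (fst z) - h z)) \<longlongrightarrow> 0) (at z within center_bundle P)"
  proof (rule Lim_null_comparison)
    show "\<forall>\<^sub>F z in at z within center_bundle P.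
        norm (center_map z - (v (fst z) - h z)) \<le> 1 / 2 * norm (snd z - h z)"
      unfolding eventually_at_filter
    proof (intro always_eventually allI impI)
      fix z assume "z \<in> center_bundle P"
      then show "norm (center_map z - (v (fst z) - h z)) \<le> 1 / 2 * norm (snd z - h z)"
        using center_map_lipschitz[of "fst z" "snd z" "h z"] center_map_of_solution[OF v(1), of "fst z"]
        by (simp add: h_def)
    qed
    have "((\<lambda>z. 1 / 2 * norm (snd z - h z)) \<longlongrightarrow> 1 / 2 * norm (\<xi> - \<xi>)) (at z within center_bundle P)"
      by (intro tendsto_intros snd_lim lim)
    then show "((\<lambda>z. 1 / 2 * norm (snd z - h z)) \<longlongrightarrow> 0) (at z within center_bundle P)" by simp
  qed
  from tendsto_add[OF this tendsto_diff[OF lim(2) lim(1)]]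
  show "(center_map \<longlongrightarrow> center_map z) (at z within center_bundle P)"
    using center_map_of_solution(2)[OF v(1), of s] v(2) z_eq by simp
qed

lemma center_map_mem: "center_map \<in> A_N P Qp Qm (1 / 2)"
proof -
  have "center_map (t, 0) = 0" for t
  proof -
    have "center_solution (\<lambda>_. 0)"
      unfolding center_solution_def
      by (intro conjI zero_solution exI[of _ 1]) (simp add: less_imp_le[OF alpha_pos])
    from center_map_of_solution(2)[OF this, of t] show ?thesis by (simp add: blinfun.zero_right)
  qed
  moreover have "\<exists>u\<in>range (Qp s). \<exists>w\<in>range (Qm s). center_map (s, \<xi>) = u + w"
    if b: "(s, \<xi>) \<in> center_bundle P" for s \<xi>
  proof -
    obtain v where v: "center_solution v" "P s (v s) = \<xi>" by (rule bundle_point_of_solution[OF b])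
    have "center_map (s, \<xi>) = Qp s (v s) + Qm s (v s)"
      using center_map_of_solution(2)[OF v(1), of s] v(2) by (simp add: Qm_eq)
    then show ?thesis by blast
  qed
  ultimately show ?thesis
    using center_map_cont center_map_lipschitz
    by (auto simp: A_N_def center_map_def center_bundle_iff range_P_iff)
qed

theorem center_manifold_exists:
  assumes k: "1 / (1 - 2 * \<delta>) \<le> k"
  shows "center_manifold (1 / 2) k center_map"
proof -
  have flow: "flow_map A f \<tau> (s, v s) = (s + \<tau>, v (s + \<tau>))" if "center_solution v" for \<tau> s v
    using that by (intro flow_map_eq) (simp add: center_solution_def)
  then have "flow_map A f \<tau> ` manifold P center_map \<subseteq> manifold P center_map" for \<tau>
    unfolding manifold_center_map by fastforce
  moreover have "norm (snd (flow_map A f (t - s) (graph_point center_map s \<xi>)) -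
        snd (flow_map A f (t - s) (graph_point center_map s \<xi>'))) \<le> k * \<alpha> t s * norm (\<xi> - \<xi>')"
    if r: "\<xi> \<in> range (P s)" "\<xi>' \<in> range (P s)" for t s \<xi> \<xi>'
  proof -
    have b: "(s, \<xi>) \<in> center_bundle P" "(s, \<xi>') \<in> center_bundle P"
      using r by (simp_all add: center_bundle_def)
    obtain v where v: "center_solution v" "P s (v s) = \<xi>" by (rule bundle_point_of_solution[OF b(1)])
    obtain w where w: "center_solution w" "P s (w s) = \<xi>'" by (rule bundle_point_of_solution[OF b(2)])
    have "norm (snd (flow_map A f (t - s) (graph_point center_map s \<xi>)) -
        snd (flow_map A f (t - s) (graph_point center_map s \<xi>'))) = norm (v t - w t)"
      using center_map_of_solution(3)[OF v(1), of s] center_map_of_solution(3)[OF w(1), of s] v w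
      by (simp add: flow)
    also have "\<dots> \<le> 1 / (1 - 2 * \<delta>) * (\<alpha> t s * norm (\<xi> - \<xi>'))"
      using center_solution_difference[OF v(1) w(1), of t s] v(2) w(2)
      by (simp add: blinfun.diff_right mult.commute)
    also have "\<dots> \<le> k * (\<alpha> t s * norm (\<xi> - \<xi>'))"
      using less_imp_le[OF alpha_pos] by (intro mult_right_mono k) simp
    finally show ?thesis by (simp only: mult.assoc)
  qed
  ultimately show ?thesis
    unfolding center_manifold_def using center_map_mem by blast
qed

text \<open>Comparing with the zero orbit, the growth bound makes every orbit on the graph of \<open>\<psi>\<close> a center
  solution, and center solutions are determined by their center component.\<close>

theorem center_manifold_unique:
  assumes \<psi>: "center_manifold N k \<psi>"
  shows "\<psi> = center_map"
proof
  fix z :: "real \<times> 'a"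
  obtain s \<xi> where z: "z = (s, \<xi>)" by fastforce
  have mem: "\<psi> \<in> A_N P Qp Qm N" using \<psi> by (simp add: center_manifold_def)
  show "\<psi> z = center_map z"
  proof (cases "z \<in> center_bundle P")
    case False
    then show ?thesis using A_N_extensional[OF mem] A_N_extensional[OF center_map_mem] by simp
  next
    case True
    then have \<xi>: "P s \<xi> = \<xi>" using z by (simp add: center_bundle_iff)
    obtain w where w: "ode_solution rhs w" "w s = \<xi> + \<psi> (s, \<xi>)"
      using perturbed_solution_exists by blast
    have "norm (w t) \<le> (k * norm \<xi>) * \<alpha> t s" for t
    proof -
      have "\<xi> \<in> range (P s)" "0 \<in> range (P s)"
        using \<xi> by (auto simp: range_P_iff blinfun.zero_right)
      then have "norm (snd (flow_map A f (t - s) (graph_point \<psi> s \<xi>)) -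
          snd (flow_map A f (t - s) (graph_point \<psi> s 0))) \<le> k * \<alpha> t s * norm (\<xi> - 0)"
        using \<psi> unfolding center_manifold_def by blast
      moreover have "graph_point \<psi> s \<xi> = (s, w s)" "graph_point \<psi> s 0 = (s, 0)"
        using w(2) A_N_zero[OF mem] by (simp_all add: graph_point_def)
      ultimately show ?thesis
        by (simp add: flow_map_eq[OF w(1)] flow_map_zero mult_ac)
    qed
    then have "center_solution w"
      using w(1) center_growth_rebase unfolding center_solution_def by blast
    moreover have "P s (w s) = \<xi>"
      using w(2) \<xi> A_N_P_zero[OF mem] True z by (simp add: blinfun.add_right)
    ultimately show ?thesis
      using center_map_of_solution(2)[of w s] w(2) z by simp
  qed
qed

end

theorem (in perturbed_trichotomy) unique_center_manifold:
  assumes "1 / (1 - 2 * \<delta>) \<le> k"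
  shows "\<exists>!\<phi>. center_manifold (1 / 2) k \<phi>"
proof (cases "P 0 = 0")
  case True
  then show ?thesis by (rule trivial_center_manifold) simp
next
  case False
  interpret central_trichotomy \<rho> \<rho>' a b c d D \<epsilon> \<delta> \<gamma> A T P Qp Qm f
    by unfold_locales (rule False)
  show ?thesis
  proof (rule ex1I)
    show "center_manifold (1 / 2) k center_map" by (rule center_manifold_exists[OF assms])
    show "\<phi> = center_map" if "center_manifold (1 / 2) k \<phi>" for \<phi>
      by (rule center_manifold_unique[OF that])
  qed
qed

section \<open>The global Lipschitz center manifold\<close>

lemma Lip_bound:
  assumes "Lip g < \<infinity>" shows "norm (g x - g y) \<le> enn2real (Lip g) * norm (x - y)"
proof (cases "x = y")
  case False
  have "ennreal (norm (g x - g y) / norm (x - y)) \<le> Lip g"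
    unfolding Lip_def using False by (intro SUP_upper2[of "(x, y)"]) auto
  then have "norm (g x - g y) / norm (x - y) \<le> enn2real (Lip g)"
    using assms enn2real_mono[of "ennreal (norm (g x - g y) / norm (x - y))" "Lip g"] by simp
  then show ?thesis using False by (simp add: pos_divide_le_eq)
qed simp

theorem theorem4p3:
  fixes A :: "real \<Rightarrow> 'a::banach \<Rightarrow>\<^sub>L 'a"
    and T :: "real \<Rightarrow> real \<Rightarrow> 'a \<Rightarrow>\<^sub>L 'a"
    and P Qp Qm :: "real \<Rightarrow> 'a \<Rightarrow>\<^sub>L 'a"
    and f :: "real \<Rightarrow> 'a \<Rightarrow> 'a"
    and \<rho> :: "real \<Rightarrow> real"
    and a b c d D \<epsilon> \<delta> \<gamma> :: real
    and \<omega> :: ennreal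
  assumes "continuous_on UNIV A"
    and "evolution_operator A T"
    and "\<And>t. \<rho> (- t) = - \<rho> t" and "mono \<rho>" and "\<And>t. \<rho> differentiable (at t)"
    and "filterlim \<rho> at_top at_top"
    and "D \<ge> 1" and "\<epsilon> \<ge> 0"
    and "generalized_trichotomy T P Qp Qm
           (rho_alpha \<rho> D \<epsilon> a c) (rho_beta_plus \<rho> D \<epsilon> d) (rho_beta_minus \<rho> D \<epsilon> b)"
    and "continuous_on UNIV (\<lambda>(t, x). f t x)"
    and "\<And>t. f t 0 = 0" and "\<And>t. Lip (f t) < \<infinity>"
    and "\<And>r. r \<noteq> 0 \<Longrightarrow>
           enn2real (Lip (f r)) \<le> \<delta> * deriv \<rho> r / (D\<^sup>2 * exp (2 * \<epsilon> * \<bar>\<rho> r\<bar>)) *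
             Min {- c - d - \<epsilon> * sgn r, - a - b + \<epsilon> * sgn r,
                  D * \<gamma> / 2 * exp ((\<epsilon> - \<gamma>) * \<bar>\<rho> r\<bar>)}"
    and "\<delta> < 1 / 6"
    and "\<epsilon> > 0 \<Longrightarrow> \<gamma> = \<epsilon>"
    and "\<epsilon> = 0 \<Longrightarrow> 0 < \<gamma> \<and> \<gamma> < 2 / D * min (- c - d) (- a - b)"
    and "\<omega> = omega_const (rho_alpha \<rho> D \<epsilon> a c) (rho_beta_plus \<rho> D \<epsilon> d)
               (rho_beta_minus \<rho> D \<epsilon> b) f"
    and "\<omega> > 0"
    and "a + b + \<epsilon> < 0" and "c + d + \<epsilon> < 0"
  shows "\<exists>N::real. 0 < N \<and> N < 1 \<and>
    (\<exists>!\<phi>. \<phi> \<in> A_N P Qp Qm N \<and>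
      (\<forall>\<tau>. flow_map A f \<tau> ` manifold P \<phi> \<subseteq> manifold P \<phi>) \<and>
      (\<forall>t s. \<forall>\<xi> \<in> range (P s). \<forall>\<xi>' \<in> range (P s).
        norm (snd (flow_map A f (t - s) (graph_point \<phi> s \<xi>)) -
              snd (flow_map A f (t - s) (graph_point \<phi> s \<xi>')))
          \<le> (if s \<le> t
             then D * N / enn2real \<omega> * exp (a * (\<rho> t - \<rho> s) + \<epsilon> * \<bar>\<rho> s\<bar>) * norm (\<xi> - \<xi>')
             else D * N / enn2real \<omega> * exp (c * (\<rho> s - \<rho> t) + \<epsilon> * \<bar>\<rho> s\<bar>) * norm (\<xi> - \<xi>'))))"
proof -
  \<comment> \<open>A negative \<open>\<delta>\<close> may be replaced by 0, because the minimum and \<open>\<rho>'\<close> are nonnegative.\<close>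
  define \<delta>' where "\<delta>' = max \<delta> 0"
  have \<gamma>: "0 < \<gamma>"
    using assms(8,15,16) by (cases "\<epsilon> = 0") auto
  interpret trichotomy_rates \<rho> "deriv \<rho>" a b c d D \<epsilon> \<delta>' \<gamma>
    by unfold_locales
      (use assms(3-8,14,19,20) \<gamma> in \<open>auto simp: \<delta>'_def DERIV_deriv_iff_real_differentiable\<close>)
  have Lip_le: "enn2real (Lip (f r)) \<le> lip_bound r" if "r \<noteq> 0" for r
  proof -
    have nonneg: "0 \<le> deriv \<rho> r / (D\<^sup>2 * exp (2 * \<epsilon> * \<bar>\<rho> r\<bar>))"
      using rho'_nonneg[of r] by simp
    have "enn2real (Lip (f r)) \<le> \<delta> * (deriv \<rho> r / (D\<^sup>2 * exp (2 * \<epsilon> * \<bar>\<rho> r\<bar>)) *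
        min (min (- c - d - \<epsilon> * sgn r) (- a - b + \<epsilon> * sgn r)) (D * \<gamma> / 2 * exp ((\<epsilon> - \<gamma>) * \<bar>\<rho> r\<bar>)))"
      using assms(13)[OF that] by (simp add: min.assoc mult.assoc)
    also have "\<dots> \<le> \<delta>' * (deriv \<rho> r / (D\<^sup>2 * exp (2 * \<epsilon> * \<bar>\<rho> r\<bar>)) *
        min (min (- c - d - \<epsilon> * sgn r) (- a - b + \<epsilon> * sgn r)) (D * \<gamma> / 2 * exp ((\<epsilon> - \<gamma>) * \<bar>\<rho> r\<bar>)))"
      by (intro mult_right_mono mult_nonneg_nonneg[OF nonneg lip_bound_min_nonneg])
        (simp add: \<delta>'_def)
    finally show ?thesis by (simp add: lip_bound_def mult.assoc)
  qed
  interpret perturbed_trichotomy \<rho> "deriv \<rho>" a b c d D \<epsilon> \<delta>' \<gamma> A T P Qp Qm f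
  proof unfold_locales
    show "norm (f t x - f t y) \<le> lip_bound t * norm (x - y)" if "t \<noteq> 0" for t x y
      using Lip_bound[OF assms(12)[of t], of x y] mult_right_mono[OF Lip_le[OF that] norm_ge_zero[of "x - y"]]
      by linarith
  qed (use assms(1,2,9-11) in auto)
  define w where "w = enn2real \<omega>"
  have "\<omega> \<le> ennreal (2 * \<delta>')"
    unfolding assms(17)
  proof (rule omega_le)
    show "Lip (f r) \<le> ennreal (lip_bound r)" if "r \<noteq> 0" for r
    proof -
      have "Lip (f r) = ennreal (enn2real (Lip (f r)))" using assms(12)[of r] by simp
      also have "\<dots> \<le> ennreal (lip_bound r)" by (rule ennreal_leI[OF Lip_le[OF that]])
      finally show ?thesis .
    qed
  qed
  then have w: "0 < w" "w \<le> 2 * \<delta>'"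
    using assms(18) delta enn2real_mono[of \<omega> "ennreal (2 * \<delta>')"]
    by (auto simp: w_def enn2real_positive_iff intro: le_less_trans)
  \<comment> \<open>The growth constant of the center solutions is at most \<open>N / \<omega>\<close> for \<open>N = 1 / 2\<close>.\<close>
  have "1 / (1 - 2 * \<delta>') \<le> 3 / 2"
    using delta by (simp add: pos_divide_le_eq)
  also have "3 / 2 \<le> (1 / 2) / w"
    using w delta by (simp add: pos_le_divide_eq)
  finally have unique: "\<exists>!\<phi>. center_manifold (1 / 2) ((1 / 2) / w) \<phi>"
    by (rule unique_center_manifold)
  have bound_eq: "(if s \<le> t
       then D * (1 / 2) / enn2real \<omega> * exp (a * (\<rho> t - \<rho> s) + \<epsilon> * \<bar>\<rho> s\<bar>) * n
       else D * (1 / 2) / enn2real \<omega> * exp (c * (\<rho> s - \<rho> t) + \<epsilon> * \<bar>\<rho> s\<bar>) * n)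
     = (1 / 2) / w * \<alpha> t s * n" for s t n
    by (simp add: rho_alpha_def w_def)
  show ?thesis
    by (rule exI[of _ "1 / 2"], unfold bound_eq, fold center_manifold_def) (use unique in simp)
qed

end
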